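(* Let $\delta>0$ and let $q\in L^\infty(-\infty,t_0)$ for some $t_0\in\mathbb{R}$. Assume that: - there exists $\eta>0$ for which $q(t)\ge\eta$ for almost every $t\in\,]-\infty,t_0[$; - there exists $c>0$ for which $q\equiv c$ in $[t_0,+\infty[$. Let $f\colon[0,1]\to\mathbb{R}$ be a Lipschitz continuous function such that $f(0)=f(1)=0$ and there exists $\alpha\in\,]0,1[$ with $f(\alpha)=0$, $f(s)<0$ for all $s\in\,]0,\alpha[$ and $f(s)>0$ for all $s\in\,]\alpha,1[$. Let $F(v)=\int_0^v f(s)\,\mathrm{d}s$ and assume $F(1)>0$. Then, if $$c\le\eta\,\frac{-F(\alpha)}{F(1)-F(\alpha)},$$ there exists a strictly increasing heteroclinic solution of $$\delta\bigl(\phi(v'(t))\bigr)'+q(t)f(v(t))=0,\quad t\in\mathbb{R}.$$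
   Context: $\phi(\xi)=\dfrac{\xi}{\sqrt{1-\xi^2}}$ for $\xi\in\,]-1,1[$. A solution is a continuously differentiable function $v\colon\mathbb{R}\to[0,1]$, with $v'$ absolutely continuous, which satisfies the equation almost everywhere. A heteroclinic solution is a solution $v$ which is strictly increasing with $\lim_{t\to-\infty}v(t)=0$ and $\lim_{t\to+\infty}v(t)=1$. *)

theory Defs
  imports "HOL-Analysis.Analysis"
begin

text \<open>Meaningful for \<open>\<bar>\<xi>\<bar> < 1\<close> only; since Isabelle functions are total, that restriction is imposed
  on the derivative of a solution below.\<close>

definition phi :: "real \<Rightarrow> real" where
  "phi \<xi> = \<xi> / sqrt (1 - \<xi>\<^sup>2)"

text \<open>Membership in \<open>L\<^sup>\<infinity>(S)\<close>, with respect to Lebesgue measure.\<close>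

definition L_infinity_on :: "real set \<Rightarrow> (real \<Rightarrow> real) \<Rightarrow> bool" where
  "L_infinity_on S q \<longleftrightarrow>
     q \<in> borel_measurable (lebesgue_on S) \<and> (\<exists>K. AE t in lebesgue_on S. \<bar>q t\<bar> \<le> K)"

text \<open>Absolute continuity of a function on an interval \<open>S\<close>; the library only has absolute continuity
  of measures.\<close>

definition absolutely_continuous_on :: "real set \<Rightarrow> (real \<Rightarrow> real) \<Rightarrow> bool" where
  "absolutely_continuous_on S g \<longleftrightarrow>
     (\<forall>e>0. \<exists>d>0. \<forall>(n::nat) a b.
        (\<forall>i<n. a i \<le> b i \<and> {a i..b i} \<subseteq> S) \<and>
        disjoint_family_on (\<lambda>i. {a i<..<b i}) {..<n} \<and>
        (\<Sum>i<n. b i - a i) < d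
        \<longrightarrow> (\<Sum>i<n. \<bar>g (b i) - g (a i)\<bar>) < e)"

text \<open>\<open>potential f v\<close> is \<open>F(v) = \<integral>\<^sub>0\<^sup>v f(s) ds\<close>, used for \<open>v \<in> [0,1]\<close> only.\<close>

definition potential :: "(real \<Rightarrow> real) \<Rightarrow> real \<Rightarrow> real" where
  "potential f v = integral {0..v} f"

text \<open>The equation is \<open>\<delta> (\<phi>(v'))' + q(t) f(v) = 0\<close> on the whole line.
  The derivative \<open>(\<phi>(v'))'\<close> is required to exist at almost every \<open>t\<close>. Absolute continuity of \<open>v'\<close>
  is taken on all of \<open>\<real>\<close>: when \<open>q\<close> is essentially bounded and \<open>f\<close> is bounded on \<open>[0,1]\<close>, a locally
  absolutely continuous \<open>v'\<close> solving the equation is Lipschitz, so the local reading is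
  equivalent.\<close>

definition is_solution :: "real \<Rightarrow> (real \<Rightarrow> real) \<Rightarrow> (real \<Rightarrow> real) \<Rightarrow> (real \<Rightarrow> real) \<Rightarrow> bool" where
  "is_solution \<delta> q f v \<longleftrightarrow>
     (\<forall>t. v t \<in> {0..1}) \<and>
     v C1_differentiable_on UNIV \<and>
     (\<forall>t. \<bar>deriv v t\<bar> < 1) \<and>
     absolutely_continuous_on UNIV (deriv v) \<and>
     (AE t in lebesgue. \<exists>D. ((\<lambda>s. phi (deriv v s)) has_real_derivative D) (at t) \<and>
                            \<delta> * D + q t * f (v t) = 0)"

definition heteroclinic_solution ::
    "real \<Rightarrow> (real \<Rightarrow> real) \<Rightarrow> (real \<Rightarrow> real) \<Rightarrow> (real \<Rightarrow> real) \<Rightarrow> bool" where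
  "heteroclinic_solution \<delta> q f v \<longleftrightarrow>
     is_solution \<delta> q f v \<and> strict_mono v \<and> (v \<longlongrightarrow> 0) at_bot \<and> (v \<longlongrightarrow> 1) at_top"

end

theory Submission
  imports Defs
begin

text \<open>Write \<open>p = \<phi>(v')\<close>, so that the equation becomes the system \<open>v' = p / sqrt (1 + p\<^sup>2)\<close>,
  \<open>p' = - q f(v) / \<delta>\<close>. On \<open>[t\<^sub>0, \<infinity>)\<close> the energy \<open>\<delta> sqrt (1 + p\<^sup>2) + c F(v)\<close> is conserved, and the positive
  part of its level set through \<open>(1, 0)\<close> consists of orbits increasing to \<open>1\<close>. Starting from a point
  \<open>v(t\<^sub>0) = a \<in> (0, \<alpha>]\<close> of this level set and going back in time, either \<open>p\<close> becomes negative while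
  \<open>v > 0\<close>, or \<open>v\<close> becomes negative while \<open>p > 0\<close>, or the orbit stays in the positive quadrant and tends
  to \<open>(0, 0)\<close>. The first two conditions on \<open>a\<close> are open and exclusive; the second holds for small \<open>a\<close>
  and, by comparing the energies with weights \<open>c\<close> and \<open>\<eta>\<close>, fails for \<open>a = \<alpha>\<close>. As \<open>(0, \<alpha>]\<close> is connected,
  some \<open>a\<close> realises the third alternative.\<close>

subsection \<open>The relativistic velocity\<close>

text \<open>The inverse of \<open>phi\<close>. Taking the momentum as unknown makes the velocity a
  globally Lipschitz function of it, and the constraint \<open>\<bar>v'\<bar> < 1\<close> becomes
  automatic.\<close>

definition psi :: "real \<Rightarrow> real" where
  "psi p = p / sqrt (1 + p\<^sup>2)"

lemma one_plus_square_pos: "0 < 1 + (p::real)\<^sup>2"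
  by (rule add_pos_nonneg) auto

lemma psi_zero [simp]: "psi 0 = 0"
  by (simp add: psi_def)

lemma psi_pos: "0 < p \<Longrightarrow> 0 < psi p"
  by (simp add: psi_def one_plus_square_pos)

lemma abs_psi_less_1: "\<bar>psi p\<bar> < 1"
proof -
  have "\<bar>p\<bar> = sqrt (p\<^sup>2)" by simp
  also have "\<dots> < sqrt (1 + p\<^sup>2)" by (subst real_sqrt_less_iff) simp
  finally show ?thesis
    using one_plus_square_pos[of p] by (simp add: psi_def abs_divide)
qed

text \<open>This makes \<open>psi\<close> the gradient of the kinetic term, so the system is
  Hamiltonian for a constant weight; both energy arguments below rest on it.\<close>

lemma DERIV_sqrt_one_plus_square: "((\<lambda>p. sqrt (1 + p\<^sup>2)) has_real_derivative psi p) (at p)"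
  unfolding psi_def using one_plus_square_pos[of p]
  by (auto intro!: derivative_eq_intros simp: field_simps)

lemma DERIV_psi: "(psi has_real_derivative 1 / ((1 + p\<^sup>2) * sqrt (1 + p\<^sup>2))) (at p)"
proof -
  have s: "0 < sqrt (1 + p\<^sup>2)" "sqrt (1 + p\<^sup>2) \<noteq> 0" "sqrt (1 + p\<^sup>2) * sqrt (1 + p\<^sup>2) = 1 + p\<^sup>2"
    using one_plus_square_pos[of p] by auto
  have "((\<lambda>p. p / sqrt (1 + p\<^sup>2)) has_real_derivative
      (1 * sqrt (1 + p\<^sup>2) - p * psi p) / (sqrt (1 + p\<^sup>2) * sqrt (1 + p\<^sup>2))) (at p)"
    by (rule DERIV_divide DERIV_ident DERIV_sqrt_one_plus_square s)+
  moreover have "(1 * sqrt (1 + p\<^sup>2) - p * psi p) / (sqrt (1 + p\<^sup>2) * sqrt (1 + p\<^sup>2))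
      = 1 / ((1 + p\<^sup>2) * sqrt (1 + p\<^sup>2))"
  proof -
    have "sqrt (1 + p\<^sup>2) - p * psi p = (sqrt (1 + p\<^sup>2) * sqrt (1 + p\<^sup>2) - p * p) / sqrt (1 + p\<^sup>2)"
      unfolding psi_def using s(1) by (simp add: divide_simps)
    also have "\<dots> = 1 / sqrt (1 + p\<^sup>2)"
      unfolding s(3) by (simp add: power2_eq_square)
    finally show ?thesis unfolding s(3) by (simp add: mult.commute)
  qed
  ultimately show ?thesis unfolding psi_def[abs_def] by simp
qed

lemma psi_strict_mono: "x < y \<Longrightarrow> psi x < psi y"
  by (rule DERIV_pos_imp_increasing)
    (auto intro!: exI DERIV_psi divide_pos_pos mult_pos_pos one_plus_square_pos)

lemma psi_mono: "x \<le> y \<Longrightarrow> psi x \<le> psi y"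
  using psi_strict_mono[of x y] by (cases "x = y") auto

lemma psi_lipschitz: "\<bar>psi x - psi y\<bar> \<le> \<bar>x - y\<bar>"
proof -
  have *: "norm (psi x - psi y) \<le> 1 * norm (x - y)"
  proof (rule field_differentiable_bound[of UNIV])
    fix z :: real
    have "1 \<le> 1 + z\<^sup>2" "1 \<le> sqrt (1 + z\<^sup>2)" by auto
    from mult_mono'[OF this] have "1 \<le> (1 + z\<^sup>2) * sqrt (1 + z\<^sup>2)" by simp
    then show "norm (1 / ((1 + z\<^sup>2) * sqrt (1 + z\<^sup>2))) \<le> 1" by simp
  qed (auto intro: DERIV_psi)
  then show ?thesis by simp
qed

lemma continuous_on_psi [continuous_intros]: "continuous_on S psi"
  by (rule DERIV_continuous_on[OF has_field_derivative_at_within[OF DERIV_psi]])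

lemma phi_psi: "phi (psi p) = p"
proof -
  have "1 - (psi p)\<^sup>2 = (1 + p\<^sup>2 - p\<^sup>2) / (1 + p\<^sup>2)"
    unfolding diff_divide_distrib using one_plus_square_pos[of p]
    by (simp add: psi_def power_divide)
  then have "sqrt (1 - (psi p)\<^sup>2) = 1 / sqrt (1 + p\<^sup>2)"
    by (simp add: real_sqrt_divide)
  then show ?thesis
    using one_plus_square_pos[of p] by (simp add: phi_def psi_def)
qed

subsection \<open>Integrals of locally integrable functions\<close>

text \<open>An interval with reversed ends is empty and contributes 0, so at least one term vanishes
  and the difference is the oriented integral from \<open>a\<close> to \<open>t\<close>.\<close>

definition signed_integral :: "real \<Rightarrow> real \<Rightarrow> (real \<Rightarrow> real) \<Rightarrow> real" where
  "signed_integral a t h = integral {a..t} h - integral {t..a} h"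

lemma signed_integral_diff:
  assumes "\<And>s t. h integrable_on {s..t}" "s \<le> t"
  shows "signed_integral a t h - signed_integral a s h = integral {s..t} h"
proof -
  have c: "integral {x..y} h + integral {y..z} h = integral {x..z} h" if "x \<le> y" "y \<le> z" for x y z
    using that assms(1) by (intro Henstock_Kurzweil_Integration.integral_combine) auto
  have e: "integral {x..y} h = 0" if "y \<le> x" for x y
    using that by (cases "x = y") auto
  consider "a \<le> s" | "s < a" "a \<le> t" | "t < a" by linarith
  then show ?thesis
    unfolding signed_integral_def
    by cases (use c[of a s t] c[of s a t] c[of s t a] e[of s a] e[of t a] e[of a s] e[of a t] assms(2) in auto)
qed

lemma signed_integral_self [simp]: "signed_integral a a h = 0"
  by (simp add: signed_integral_def)

lemma abs_integral_le_increment: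
  fixes h H :: "real \<Rightarrow> real"
  assumes "h integrable_on {a..b}" "a \<le> b"
    and "\<And>r. r \<in> {a..b} \<Longrightarrow> (H has_real_derivative H' r) (at r)"
    and "\<And>r. r \<in> {a..b} \<Longrightarrow> \<bar>h r\<bar> \<le> H' r"
  shows "\<bar>integral {a..b} h\<bar> \<le> H b - H a"
proof -
  have "(H' has_integral H b - H a) {a..b}"
    using assms(2,3) by (intro fundamental_theorem_of_calculus)
      (auto simp flip: has_real_derivative_iff_has_vector_derivative intro: has_field_derivative_at_within)
  then have "norm (integral {a..b} h) \<le> integral {a..b} H'" "integral {a..b} H' = H b - H a"
    using integral_norm_bound_integral[OF assms(1), of H'] assms(4) by (auto simp: integral_unique)
  then show ?thesis by simp
qed

text \<open>Integrating the exponential weight divides it by \<kappa>; this gain is what later makes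
  the Picard map a contraction.\<close>

lemma abs_signed_integral_le:
  assumes int: "\<And>s t. h integrable_on {s..t}"
    and bound: "\<And>r. \<bar>h r\<bar> \<le> C * exp (\<kappa> * \<bar>r - a\<bar>)" and "0 < \<kappa>" "0 \<le> C"
  shows "\<bar>signed_integral a t h\<bar> \<le> C / \<kappa> * exp (\<kappa> * \<bar>t - a\<bar>)"
proof (cases "a \<le> t")
  case True
  have "\<bar>integral {a..t} h\<bar> \<le> C / \<kappa> * exp (\<kappa> * (t - a)) - C / \<kappa> * exp (\<kappa> * (a - a))"
  proof (rule abs_integral_le_increment[OF int True, where H' = "\<lambda>r. C * exp (\<kappa> * (r - a))"])
    show "((\<lambda>r. C / \<kappa> * exp (\<kappa> * (r - a))) has_real_derivative C * exp (\<kappa> * (r - a))) (at r)" for r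
      using \<open>0 < \<kappa>\<close> by (auto intro!: derivative_eq_intros)
    show "\<bar>h r\<bar> \<le> C * exp (\<kappa> * (r - a))" if "r \<in> {a..t}" for r
      using bound[of r] that by simp
  qed
  moreover have "integral {t..a} h = 0"
    using True by (cases "a = t") auto
  moreover have "0 \<le> C / \<kappa>" using assms by simp
  ultimately show ?thesis using True by (simp add: signed_integral_def)
next
  case False
  then have "t \<le> a" by simp
  \<comment> \<open>To the left of \<open>a\<close> the weight decreases in \<open>r\<close>, so its
    antiderivative carries a minus sign.\<close>
  have "\<bar>integral {t..a} h\<bar> \<le> - (C / \<kappa>) * exp (\<kappa> * (a - a)) - - (C / \<kappa>) * exp (\<kappa> * (a - t))"
  proof (rule abs_integral_le_increment[OF int \<open>t \<le> a\<close>, where H' = "\<lambda>r. C * exp (\<kappa> * (a - r))"])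
    show "((\<lambda>r. - (C / \<kappa>) * exp (\<kappa> * (a - r))) has_real_derivative C * exp (\<kappa> * (a - r))) (at r)" for r
      using \<open>0 < \<kappa>\<close> by (auto intro!: derivative_eq_intros)
    show "\<bar>h r\<bar> \<le> C * exp (\<kappa> * (a - r))" if "r \<in> {t..a}" for r
      using bound[of r] that by (simp add: abs_minus_commute)
  qed
  moreover have "integral {a..t} h = 0"
    using False by auto
  moreover have "0 \<le> C / \<kappa>" using assms by simp
  ultimately show ?thesis using False by (simp add: signed_integral_def abs_minus_commute)
qed

section \<open>Gronwall's inequality\<close>

lemma gronwall:
  fixes z :: "real \<Rightarrow> real"
  assumes cont: "continuous_on {a..b} z" and "0 \<le> M" and t: "t \<in> {a..b}"
    and le: "\<And>t. t \<in> {a..b} \<Longrightarrow> z t \<le> C + M * integral {a..t} z"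
  shows "z t \<le> C * exp (M * (t - a))"
proof -
  define U where "U t = C + M * integral {a..t} z" for t
  have dU: "(U has_real_derivative M * z x) (at x within {a..b})" if "x \<in> {a..b}" for x
    unfolding U_def using integral_has_real_derivative[OF cont that]
    by (auto intro!: derivative_eq_intros)
  \<comment> \<open>While \<open>z\<close> is merely continuous, its majorant \<open>U\<close> is
    differentiable with derivative \<open>M * z \<le> M * U\<close>; discounting \<open>U\<close> by
    the exponential therefore gives a nonincreasing function.\<close>
  have "U t * exp (- (M * (t - a))) \<le> U a * exp (- (M * (a - a)))"
  proof (rule DERIV_nonpos_imp_decreasing_open[where f = "\<lambda>t. U t * exp (- (M * (t - a)))"])
    show "a \<le> t" using t by simp
    have "continuous_on {a..b} U"
      using dU by (rule DERIV_continuous_on)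
    then have "continuous_on {a..t} U"
      by (rule continuous_on_subset) (use t in auto)
    then show "continuous_on {a..t} (\<lambda>t. U t * exp (- (M * (t - a))))"
      by (intro continuous_intros)
    fix x assume x: "a < x" "x < t"
    then have "(U has_real_derivative M * z x) (at x)"
      using dU[of x] t by (simp add: at_within_Icc_at)
    then have "((\<lambda>t. U t * exp (- (M * (t - a)))) has_real_derivative
        M * (z x - U x) * exp (- (M * (x - a)))) (at x)"
      by (auto intro!: derivative_eq_intros simp: algebra_simps)
    moreover have "M * (z x - U x) * exp (- (M * (x - a))) \<le> 0"
      using le[of x] x t \<open>0 \<le> M\<close> unfolding U_def
      by (intro mult_nonpos_nonneg mult_nonneg_nonpos) auto
    ultimately show "\<exists>y. ((\<lambda>t. U t * exp (- (M * (t - a)))) has_real_derivative y) (at x) \<and> y \<le> 0"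
      by blast
  qed
  then have "U t * exp (- (M * (t - a))) \<le> C"
    by (simp add: U_def)
  from mult_right_mono[OF this, of "exp (M * (t - a))"] have "U t \<le> C * exp (M * (t - a))"
    by (simp add: mult.assoc flip: exp_add)
  then show ?thesis using le[OF t] by (simp add: U_def)
qed

subsection \<open>Existence of the flow\<close>

text \<open>The momentum equation is stated in integral form because the weight is only measurable:
  in general \<open>p\<close> has a classical derivative only almost everywhere.\<close>

definition flow :: "(real \<Rightarrow> real) \<Rightarrow> (real \<Rightarrow> real) \<Rightarrow> (real \<Rightarrow> real) \<Rightarrow> (real \<Rightarrow> real) \<Rightarrow> bool" where
  "flow Q g v p \<longleftrightarrow>
     (\<forall>t. (v has_real_derivative psi (p t)) (at t)) \<and>
     (\<forall>s t. s \<le> t \<longrightarrow> ((\<lambda>r. Q r * g (v r)) has_integral (p t - p s)) {s..t})"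

text \<open>The bounds are pointwise and global. They will be met by altering the weight on a null
  set and extending the nonlinearity constantly outside [0, 1]; an orbit staying in ]0, 1[ does not
  notice either change.\<close>

locale relativistic_system =
  fixes Q g :: "real \<Rightarrow> real" and m K L B :: real
  assumes Q_measurable: "Q \<in> borel_measurable lebesgue"
    and m_pos: "0 < m" and Q_ge: "m \<le> Q t" and Q_le: "Q t \<le> K"
    and L_nonneg: "0 \<le> L" and g_lipschitz: "\<bar>g x - g y\<bar> \<le> L * \<bar>x - y\<bar>"
    and g_bound: "\<bar>g x\<bar> \<le> B"
begin

lemma K_pos: "0 < K"
  using m_pos Q_ge[of 0] Q_le[of 0] by linarith

lemma B_nonneg: "0 \<le> B"
  using g_bound[of 0] by linarith

lemma continuous_on_g: "continuous_on S g"
proof -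
  have "L-lipschitz_on S g"
    using L_nonneg g_lipschitz by (intro lipschitz_onI) (auto simp: dist_real_def)
  then show ?thesis by (rule lipschitz_on_continuous_on)
qed

lemma abs_Qg_le: "\<bar>Q t * g x\<bar> \<le> K * B"
  unfolding abs_mult using Q_ge[of t] Q_le[of t] m_pos g_bound[of x] by (intro mult_mono) auto

lemma integrable_Qg:
  assumes "continuous_on UNIV v"
  shows "(\<lambda>r. Q r * g (v r)) integrable_on {s..t}"
proof (rule measurable_bounded_by_integrable_imp_integrable)
  have "continuous_on UNIV (\<lambda>r. g (v r))"
    using continuous_on_compose2[OF continuous_on_g assms] by auto
  then have "(\<lambda>r. g (v r)) \<in> borel_measurable lebesgue"
    by (intro measurable_completion) (simp add: borel_measurable_continuous_onI)
  then have "(\<lambda>r. Q r * g (v r)) \<in> borel_measurable lebesgue"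
    using Q_measurable by simp
  then show "(\<lambda>r. Q r * g (v r)) \<in> borel_measurable (lebesgue_on {s..t})"
    by (rule measurable_restrict_space1)
  show "(\<lambda>_. K * B) integrable_on {s..t}"
    by (rule integrable_const_ivl)
  show "norm (Q r * g (v r)) \<le> K * B" for r
    using abs_Qg_le by simp
qed auto

lemma flow_DERIV: "flow Q g v p \<Longrightarrow> (v has_real_derivative psi (p t)) (at t)"
  by (simp add: flow_def)

lemma flow_integral: "flow Q g v p \<Longrightarrow> s \<le> t \<Longrightarrow> ((\<lambda>r. Q r * g (v r)) has_integral (p t - p s)) {s..t}"
  by (simp add: flow_def)

lemma flow_lipschitz:
  assumes "flow Q g v p"
  shows "\<bar>p t - p s\<bar> \<le> K * B * \<bar>t - s\<bar>"
proof -
  have *: "norm (p t - p s) \<le> (K * B) * measure lborel {s..t}" if "s \<le> t" for s t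
    using K_pos B_nonneg abs_Qg_le
    by (intro has_integral_bound_real[OF _ _ flow_integral[OF assms that]]) auto
  show ?thesis
    using *[of s t] *[of t s] by (cases "s \<le> t") (auto simp: abs_minus_commute)
qed

lemma continuous_on_flow:
  assumes "flow Q g v p"
  shows "continuous_on S v" "continuous_on S p"
proof -
  show "continuous_on S v"
    by (rule DERIV_continuous_on[OF has_field_derivative_at_within[OF flow_DERIV[OF assms]]])
  have "(K * B)-lipschitz_on S p"
    using flow_lipschitz[OF assms] K_pos B_nonneg by (intro lipschitz_onI) (auto simp: dist_real_def)
  then show "continuous_on S p" by (rule lipschitz_on_continuous_on)
qed

end

section \<open>Global Picard iteration\<close>

locale picard = relativistic_system +
  fixes a v0 p0 :: real
begin

text \<open>The two integrations of the Picard map contribute the factors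
  \<open>K * L / \<kappa>\<close> and \<open>1 / \<kappa>\<close>; with this choice the first is at
  most 1/2 and the second at most 1.\<close>

definition \<kappa> where "\<kappa> = 1 + 2 * K * L"

lemma \<kappa>_pos: "0 < \<kappa>" and \<kappa>_ge_1: "1 \<le> \<kappa>"
  using K_pos L_nonneg by (auto simp: \<kappa>_def add_pos_nonneg)

text \<open>The Picard iteration is carried out for the displacement divided by \<open>exp (\<kappa> \<bar>t - a\<bar>)\<close>: with this weight
  it contracts in the supremum norm over the whole line, so no continuation of local solutions is
  needed.\<close>

definition position :: "(real \<Rightarrow>\<^sub>C real) \<Rightarrow> real \<Rightarrow> real" where
  "position y t = v0 + exp (\<kappa> * \<bar>t - a\<bar>) * y t"

text \<open>Recovering the momentum from the position by integrating the force leaves the position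
  as the only unknown of the fixed point problem.\<close>

definition momentum :: "(real \<Rightarrow>\<^sub>C real) \<Rightarrow> real \<Rightarrow> real" where
  "momentum y t = p0 + signed_integral a t (\<lambda>r. Q r * g (position y r))"

definition displacement :: "(real \<Rightarrow>\<^sub>C real) \<Rightarrow> real \<Rightarrow> real" where
  "displacement y t = signed_integral a t (\<lambda>r. psi (momentum y r))"

lemma continuous_position: "continuous_on S (position y)"
  unfolding position_def by (intro continuous_intros continuous_on_apply_bcontfun)

lemma integrable_force: "(\<lambda>r. Q r * g (position y r)) integrable_on {s..t}"
  by (rule integrable_Qg[OF continuous_position])

lemma momentum_diff:
  "s \<le> t \<Longrightarrow> momentum y t - momentum y s = integral {s..t} (\<lambda>r. Q r * g (position y r))"
  using signed_integral_diff[OF integrable_force] by (simp add: momentum_def)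

lemma continuous_momentum: "continuous_on S (momentum y)"
proof -
  have *: "\<bar>momentum y t - momentum y s\<bar> \<le> K * B * (t - s)" if "s \<le> t" for s t
    using has_integral_bound_real[OF _ _ integrable_integral[OF integrable_force[of y s t]], of "K * B" "{}"]
      that K_pos B_nonneg abs_Qg_le by (auto simp: momentum_diff)
  have "(K * B)-lipschitz_on S (momentum y)"
  proof (rule lipschitz_onI)
    show "dist (momentum y s) (momentum y t) \<le> K * B * dist s t" for s t
      using *[of s t] *[of t s] by (cases "s \<le> t") (auto simp: dist_real_def abs_minus_commute)
  qed (use K_pos B_nonneg in auto)
  then show ?thesis by (rule lipschitz_on_continuous_on)
qed

lemma continuous_velocity: "continuous_on S (\<lambda>r. psi (momentum y r))"
  using continuous_on_compose2[OF continuous_on_psi continuous_momentum] by auto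

lemma integrable_velocity: "(\<lambda>r. psi (momentum y r)) integrable_on {s..t}"
  by (rule integrable_continuous_real[OF continuous_velocity])

lemma DERIV_displacement: "(displacement y has_real_derivative psi (momentum y t)) (at t)"
proof -
  define h where "h = (\<lambda>r. psi (momentum y r))"
  \<comment> \<open>Moving the base point to \<open>t - 1\<close> puts \<open>t\<close> in the
    interior: near \<open>t\<close> the signed integral is a constant plus an ordinary integral,
    wherever \<open>a\<close> lies.\<close>
  have "((\<lambda>x. integral {t - 1..x} h) has_real_derivative h t) (at t within {t - 1..t + 1})"
    by (rule integral_has_real_derivative) (auto simp: h_def continuous_velocity)
  then have "((\<lambda>x. integral {t - 1..x} h) has_real_derivative h t) (at t)"
    by (simp add: at_within_Icc_at)
  then have "((\<lambda>x. displacement y (t - 1) + integral {t - 1..x} h) has_real_derivative h t) (at t)"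
    by (auto intro!: derivative_eq_intros)
  moreover have "\<forall>\<^sub>F x in nhds t. displacement y (t - 1) + integral {t - 1..x} h = displacement y x"
  proof -
    have "displacement y (t - 1) + integral {t - 1..x} h = displacement y x" if "x \<in> {t - 1<..}" for x
      using signed_integral_diff[OF integrable_velocity, of "t - 1" x a y] that
      by (simp add: displacement_def h_def)
    moreover have "\<forall>\<^sub>F x in nhds t. x \<in> {t - 1<..}"
      by (intro eventually_nhds_in_open) auto
    ultimately show ?thesis
      by (rule eventually_mono[rotated])
  qed
  ultimately have "(displacement y has_real_derivative h t) (at t)"
    by (subst DERIV_cong_ev[OF refl _ refl, symmetric])
  then show ?thesis by (simp add: h_def)
qed

text \<open>Speeds are below 1, hence below the weight, whose integral is controlled by
  \<open>1 / \<kappa>\<close> times itself. The Picard map thus takes values in the bounded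
  continuous functions.\<close>

lemma displacement_weighted_bcontfun:
  "(\<lambda>t. exp (- \<kappa> * \<bar>t - a\<bar>) * displacement y t) \<in> bcontfun"
proof -
  have "continuous_on UNIV (displacement y)"
    by (rule DERIV_continuous_on[OF has_field_derivative_at_within[OF DERIV_displacement]])
  then have "continuous_on UNIV (\<lambda>t. exp (- \<kappa> * \<bar>t - a\<bar>) * displacement y t)"
    by (intro continuous_intros)
  moreover have "norm (exp (- \<kappa> * \<bar>t - a\<bar>) * displacement y t) \<le> 1 / \<kappa>" for t
  proof -
    have "\<bar>psi (momentum y r)\<bar> \<le> 1 * exp (\<kappa> * \<bar>r - a\<bar>)" for r
      using abs_psi_less_1[of "momentum y r"] one_le_exp_iff[of "\<kappa> * \<bar>r - a\<bar>"] \<kappa>_pos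
      by (smt (verit) mult_nonneg_nonneg)
    from abs_signed_integral_le[OF integrable_velocity this \<kappa>_pos]
    have "\<bar>displacement y t\<bar> \<le> 1 / \<kappa> * exp (\<kappa> * \<bar>t - a\<bar>)"
      by (simp add: displacement_def)
    from mult_left_mono[OF this, of "exp (- \<kappa> * \<bar>t - a\<bar>)"] show ?thesis
      by (simp add: abs_mult mult.commute mult.left_commute flip: exp_add)
  qed
  then have "bounded (range (\<lambda>t. exp (- \<kappa> * \<bar>t - a\<bar>) * displacement y t))"
    by (auto simp: bounded_iff)
  ultimately show ?thesis by (simp add: bcontfun_def)
qed

text \<open>Positions differ by at most the weight times \<open>dist y z\<close>; the Lipschitz
  bounds for force and velocity and two integrations of the weight then produce the factor
  1/2.\<close>

lemma displacement_contraction: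
  "\<bar>displacement y t - displacement z t\<bar> \<le> dist y z / 2 * exp (\<kappa> * \<bar>t - a\<bar>)"
proof -
  have "\<bar>Q r * g (position y r) - Q r * g (position z r)\<bar> \<le> (K * L * dist y z) * exp (\<kappa> * \<bar>r - a\<bar>)" for r
  proof -
    have "\<bar>g (position y r) - g (position z r)\<bar> \<le> L * \<bar>position y r - position z r\<bar>"
      by (rule g_lipschitz)
    also have "\<bar>position y r - position z r\<bar> = exp (\<kappa> * \<bar>r - a\<bar>) * dist (y r) (z r)"
      unfolding position_def dist_real_def add_diff_add diff_self right_diff_distrib[symmetric]
      by (simp add: abs_mult)
    also have "\<dots> \<le> exp (\<kappa> * \<bar>r - a\<bar>) * dist y z"
      by (intro mult_left_mono dist_bounded) auto
    finally have "\<bar>g (position y r) - g (position z r)\<bar> \<le> L * (exp (\<kappa> * \<bar>r - a\<bar>) * dist y z)"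
      using L_nonneg by (simp add: mult_left_mono)
    then have "\<bar>Q r\<bar> * \<bar>g (position y r) - g (position z r)\<bar> \<le> K * (L * (exp (\<kappa> * \<bar>r - a\<bar>) * dist y z))"
      using Q_ge[of r] Q_le[of r] m_pos by (intro mult_mono) auto
    moreover have "\<bar>Q r * g (position y r) - Q r * g (position z r)\<bar> = \<bar>Q r\<bar> * \<bar>g (position y r) - g (position z r)\<bar>"
      unfolding right_diff_distrib[symmetric] abs_mult ..
    ultimately show ?thesis by (simp only: mult_ac)
  qed
  note bound = this
  have "0 \<le> K * L * dist y z" using K_pos L_nonneg by simp
  then have p: "\<bar>signed_integral a t (\<lambda>r. Q r * g (position y r) - Q r * g (position z r))\<bar>
      \<le> K * L * dist y z / \<kappa> * exp (\<kappa> * \<bar>t - a\<bar>)" for t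
    by (rule abs_signed_integral_le[OF integrable_diff[OF integrable_force integrable_force] bound \<kappa>_pos])
  have *: "K * L * dist y z / \<kappa> \<le> dist y z / 2"
  proof -
    have "2 * (K * L) * dist y z \<le> \<kappa> * dist y z"
      unfolding \<kappa>_def by (intro mult_right_mono) auto
    then show ?thesis using \<kappa>_pos by (simp add: pos_divide_le_eq mult_ac)
  qed
  have "\<bar>psi (momentum y r) - psi (momentum z r)\<bar> \<le> (dist y z / 2) * exp (\<kappa> * \<bar>r - a\<bar>)" for r
  proof -
    have "\<bar>psi (momentum y r) - psi (momentum z r)\<bar> \<le> \<bar>momentum y r - momentum z r\<bar>"
      by (rule psi_lipschitz)
    also have "momentum y r - momentum z r
        = signed_integral a r (\<lambda>r. Q r * g (position y r) - Q r * g (position z r))"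
      by (simp add: momentum_def signed_integral_def integral_diff integrable_force)
    also have "\<bar>\<dots>\<bar> \<le> K * L * dist y z / \<kappa> * exp (\<kappa> * \<bar>r - a\<bar>)" by (rule p)
    also have "\<dots> \<le> dist y z / 2 * exp (\<kappa> * \<bar>r - a\<bar>)" using * by (intro mult_right_mono) auto
    finally show ?thesis .
  qed
  from abs_signed_integral_le[OF integrable_diff[OF integrable_velocity integrable_velocity] this \<kappa>_pos]
  have "\<bar>signed_integral a t (\<lambda>r. psi (momentum y r) - psi (momentum z r))\<bar>
      \<le> dist y z / 2 / \<kappa> * exp (\<kappa> * \<bar>t - a\<bar>)"
    by simp
  moreover have "displacement y t - displacement z t
      = signed_integral a t (\<lambda>r. psi (momentum y r) - psi (momentum z r))"
    by (simp add: displacement_def signed_integral_def integral_diff integrable_velocity)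
  moreover have "dist y z / 2 / \<kappa> * exp (\<kappa> * \<bar>t - a\<bar>) \<le> dist y z / 2 * exp (\<kappa> * \<bar>t - a\<bar>)"
  proof (intro mult_right_mono)
    show "dist y z / 2 / \<kappa> \<le> dist y z / 2"
      using divide_left_mono[OF \<kappa>_ge_1, of "dist y z / 2"] \<kappa>_pos by simp
  qed auto
  ultimately show ?thesis by linarith
qed

lemma existence: "\<exists>v p. flow Q g v p \<and> v a = v0 \<and> p a = p0"
proof -
  define T where "T y = Bcontfun (\<lambda>t. exp (- \<kappa> * \<bar>t - a\<bar>) * displacement y t)" for y
  have T: "T y t = exp (- \<kappa> * \<bar>t - a\<bar>) * displacement y t" for y t
    unfolding T_def using Bcontfun_inverse[OF displacement_weighted_bcontfun] by metis
  have "dist (T y) (T z) \<le> 1 / 2 * dist y z" for y z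
  proof (rule dist_bound)
    fix t
    have "dist (T y t) (T z t) = exp (- \<kappa> * \<bar>t - a\<bar>) * \<bar>displacement y t - displacement z t\<bar>"
      unfolding T dist_real_def right_diff_distrib[symmetric] abs_mult by simp
    also have "\<dots> \<le> exp (- \<kappa> * \<bar>t - a\<bar>) * (dist y z / 2 * exp (\<kappa> * \<bar>t - a\<bar>))"
      by (intro mult_left_mono displacement_contraction) auto
    also have "\<dots> = 1 / 2 * dist y z"
      by (simp add: mult.commute mult.left_commute flip: exp_add)
    finally show "dist (T y t) (T z t) \<le> 1 / 2 * dist y z" .
  qed
  then obtain y where y: "T y = y"
    using banach_fix_type[of "1 / 2" T] by auto
  \<comment> \<open>Undoing the weight in \<open>T y = y\<close> shows that
    \<open>position y\<close> moves by exactly its own displacement, hence with the velocity given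
    by \<open>momentum y\<close>.\<close>
  have "displacement y t = exp (\<kappa> * \<bar>t - a\<bar>) * y t" for t
  proof -
    have "exp (\<kappa> * \<bar>t - a\<bar>) * T y t = displacement y t"
      by (simp add: T flip: exp_add mult.assoc)
    then show ?thesis by (simp add: y)
  qed
  then have pos: "position y = (\<lambda>t. v0 + displacement y t)"
    by (auto simp: position_def)
  have "flow Q g (position y) (momentum y)"
    unfolding flow_def
  proof (intro conjI allI impI)
    show "(position y has_real_derivative psi (momentum y t)) (at t)" for t
      unfolding pos using DERIV_displacement by (auto intro!: derivative_eq_intros)
    show "((\<lambda>r. Q r * g (position y r)) has_integral momentum y t - momentum y s) {s..t}" if "s \<le> t" for s t
      using that integrable_force by (simp add: momentum_diff integrable_integral)
  qed
  moreover have "displacement y a = 0" "momentum y a = p0"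
    by (simp_all add: displacement_def momentum_def)
  moreover from this have "position y a = v0"
    by (simp add: pos)
  ultimately show ?thesis by blast
qed

end

lemma (in relativistic_system) flow_exists: "\<exists>v p. flow Q g v p \<and> v a = v0 \<and> p a = p0"
proof -
  interpret picard Q g m K L B a v0 p0 ..
  show ?thesis by (rule existence)
qed

subsection \<open>Continuous dependence, uniqueness and differentiability\<close>

lemma gronwall_backward:
  fixes z :: "real \<Rightarrow> real"
  assumes cont: "continuous_on {a..b} z" and "0 \<le> M" and t: "t \<in> {a..b}"
    and le: "\<And>t. t \<in> {a..b} \<Longrightarrow> z t \<le> C + M * integral {t..b} z"
  shows "z t \<le> C * exp (M * (b - t))"
proof -
  have "z (- (- t)) \<le> C * exp (M * (- t - - b))"
  proof (rule gronwall[where z = "\<lambda>t. z (- t)" and b = "- a"])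
    show "continuous_on {- b..- a} (\<lambda>t. z (- t))"
      by (rule continuous_on_compose2[OF cont]) (auto intro!: continuous_intros)
    show "z (- x) \<le> C + M * integral {- b..x} (\<lambda>t. z (- t))" if "x \<in> {- b..- a}" for x
      using le[of "- x"] that Henstock_Kurzweil_Integration.integral_reflect_real[of b "- x" z] by simp
  qed (use t \<open>0 \<le> M\<close> in auto)
  then show ?thesis by simp
qed

context relativistic_system
begin

definition gap :: "(real \<Rightarrow> real) \<Rightarrow> (real \<Rightarrow> real) \<Rightarrow> (real \<Rightarrow> real) \<Rightarrow> (real \<Rightarrow> real) \<Rightarrow> real \<Rightarrow> real" where
  "gap v p w q t = \<bar>v t - w t\<bar> + \<bar>p t - q t\<bar>"

lemma continuous_gap:
  assumes "flow Q g v p" "flow Q g w q"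
  shows "continuous_on S (gap v p w q)"
  unfolding gap_def by (intro continuous_intros continuous_on_flow[OF assms(1)] continuous_on_flow[OF assms(2)])

text \<open>Velocities are 1-Lipschitz in the momentum and forces \<open>K * L\<close>-Lipschitz in
  the position. Bounding the increment in absolute value serves Gronwall in both time
  directions.\<close>

lemma gap_increment:
  assumes f1: "flow Q g v p" and f2: "flow Q g w q" and "s \<le> t"
  shows "\<bar>gap v p w q t - gap v p w q s\<bar> \<le> (1 + K * L) * integral {s..t} (gap v p w q)"
proof -
  let ?z = "gap v p w q"
  have z: "?z integrable_on {s..t}"
    by (rule integrable_continuous_real[OF continuous_gap[OF f1 f2]])
  have vel: "((\<lambda>r. psi (p r)) has_integral v t - v s) {s..t}" if "flow Q g v p" for v p
    using flow_DERIV[OF that] \<open>s \<le> t\<close>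
    by (intro fundamental_theorem_of_calculus)
      (auto simp flip: has_real_derivative_iff_has_vector_derivative intro: has_field_derivative_at_within)
  have 1: "((\<lambda>r. psi (p r) - psi (q r)) has_integral (v t - v s) - (w t - w s)) {s..t}"
    by (intro has_integral_diff vel f1 f2)
  have "norm (integral {s..t} (\<lambda>r. psi (p r) - psi (q r))) \<le> integral {s..t} ?z"
  proof (rule integral_norm_bound_integral[OF has_integral_integrable[OF 1] z])
    show "norm (psi (p r) - psi (q r)) \<le> gap v p w q r" for r
      using psi_lipschitz[of "p r" "q r"] by (simp add: gap_def)
  qed
  then have v: "\<bar>(v t - v s) - (w t - w s)\<bar> \<le> integral {s..t} ?z"
    using 1 by (simp add: integral_unique)
  have 2: "((\<lambda>r. Q r * g (v r) - Q r * g (w r)) has_integral (p t - p s) - (q t - q s)) {s..t}"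
    by (intro has_integral_diff flow_integral f1 f2 \<open>s \<le> t\<close>)
  have "norm (integral {s..t} (\<lambda>r. Q r * g (v r) - Q r * g (w r))) \<le> integral {s..t} (\<lambda>r. K * L * ?z r)"
  proof (rule integral_norm_bound_integral[OF has_integral_integrable[OF 2]])
    show "(\<lambda>r. K * L * ?z r) integrable_on {s..t}"
      using integrable_on_mult_right[OF z, of "K * L"] by simp
    show "norm (Q r * g (v r) - Q r * g (w r)) \<le> K * L * ?z r" for r
    proof -
      have "\<bar>g (v r) - g (w r)\<bar> \<le> L * ?z r"
        using order_trans[OF g_lipschitz mult_left_mono[OF _ L_nonneg]] by (simp add: gap_def)
      then have "\<bar>Q r\<bar> * \<bar>g (v r) - g (w r)\<bar> \<le> K * (L * ?z r)"
        using Q_ge[of r] Q_le[of r] m_pos by (intro mult_mono) auto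
      then show ?thesis
        unfolding right_diff_distrib[symmetric] by (simp add: abs_mult mult.assoc)
    qed
  qed
  then have p: "\<bar>(p t - p s) - (q t - q s)\<bar> \<le> K * L * integral {s..t} ?z"
    using 2 by (simp add: integral_unique)
  have "\<bar>?z t - ?z s\<bar> \<le> \<bar>(v t - v s) - (w t - w s)\<bar> + \<bar>(p t - p s) - (q t - q s)\<bar>"
    unfolding gap_def by linarith
  also have "\<dots> \<le> (1 + K * L) * integral {s..t} ?z"
    using v p by (simp add: distrib_right)
  finally show ?thesis .
qed

lemma gap_le:
  assumes "flow Q g v p" "flow Q g w q"
  shows "gap v p w q t \<le> gap v p w q a * exp ((1 + K * L) * \<bar>t - a\<bar>)"
proof (cases "a \<le> t")
  case True
  have "gap v p w q t \<le> gap v p w q a * exp ((1 + K * L) * (t - a))"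
    by (rule gronwall[OF continuous_gap[OF assms]])
      (use True K_pos L_nonneg gap_increment[OF assms] in \<open>auto simp: abs_le_iff algebra_simps\<close>)
  then show ?thesis using True by simp
next
  case False
  have "gap v p w q t \<le> gap v p w q a * exp ((1 + K * L) * (a - t))"
    by (rule gronwall_backward[OF continuous_gap[OF assms]])
      (use False K_pos L_nonneg gap_increment[OF assms] in \<open>auto simp: abs_le_iff algebra_simps\<close>)
  then show ?thesis using False by (simp add: abs_minus_commute)
qed

text \<open>The equilibrium is itself a flow, and a gap that vanishes once vanishes always. This
  rules out reaching (0, 0) or (1, 0) in finite time.\<close>

lemma flow_equilibrium_unique:
  assumes "flow Q g v p" "g x = 0" "v s = x" "p s = 0"
  shows "v t = x"
proof -
  have "flow Q g (\<lambda>_. x) (\<lambda>_. 0)"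
    using assms(2) by (simp add: flow_def)
  from gap_le[OF assms(1) this, of t s] assms(3,4)
  show ?thesis by (simp add: gap_def)
qed

text \<open>Lebesgue differentiation along the intervals \<open>{x..x + k}\<close> yields the right
  derivative; applied to the reflected integrand it yields the left one.\<close>

lemma AE_flow_DERIV:
  assumes "flow Q g v p"
  shows "AE t in lebesgue. (p has_real_derivative Q t * g (v t)) (at t)"
proof -
  define h where "h = (\<lambda>r. Q r * g (v r))"
  have int: "integral {s..t} h = p t - p s" "h integrable_on {s..t}" if "s \<le> t" for s t
    using flow_integral[OF assms that] by (auto simp: h_def integral_unique)
  have int': "h integrable_on {s..t}" for s t
    using int[of s t] by (cases "s \<le> t") auto
  have "h integrable_on cbox a b" for a b
    using int' by simp
  from integrable_ccontinuous_explicit[OF this] obtain N1 where N1: "negligible N1"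
    "\<And>x e. x \<notin> N1 \<Longrightarrow> 0 < e \<Longrightarrow> \<exists>d>0. \<forall>k. 0 < k \<and> k < d \<longrightarrow>
        \<bar>integral {x..x + k} h / k - h x\<bar> < e"
    by (auto simp: divide_inverse_commute)
  have "(\<lambda>x. h (- x)) integrable_on cbox a b" for a b
    using int'[of "- b" "- a"] Henstock_Kurzweil_Integration.integrable_reflect_real[of h "- a" "- b"] by simp
  from integrable_ccontinuous_explicit[OF this] obtain N2 where N2: "negligible N2"
    "\<And>x e. x \<notin> N2 \<Longrightarrow> 0 < e \<Longrightarrow> \<exists>d>0. \<forall>k. 0 < k \<and> k < d \<longrightarrow>
        \<bar>integral {x..x + k} (\<lambda>x. h (- x)) / k - h (- x)\<bar> < e"
    by (auto simp: divide_inverse_commute)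
  \<comment> \<open>Reflection is differentiable, so it maps a null set to a null set.\<close>
  have "negligible (N1 \<union> uminus ` N2)"
    using N1(1) N2(1)
    by (intro negligible_Un negligible_differentiable_image_negligible)
      (auto intro!: derivative_intros simp: differentiable_on_def)
  then have "AE t in lebesgue. t \<notin> N1 \<union> uminus ` N2"
    by (intro AE_not_in) (simp add: negligible_iff_null_sets)
  then show ?thesis
  proof eventually_elim
    case (elim t)
    then have t: "t \<notin> N1" "- t \<notin> N2"
      using image_eqI[of t uminus "- t" N2] by auto
    show ?case
      unfolding DERIV_def LIM_def
    proof (intro allI impI)
      fix e :: real assume "0 < e"
      obtain d1 where d1: "d1 > 0" "\<And>k. 0 < k \<Longrightarrow> k < d1 \<Longrightarrow> \<bar>integral {t..t + k} h / k - h t\<bar> < e"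
        using N1(2)[OF t(1) \<open>0 < e\<close>] by blast
      obtain d2 where d2: "d2 > 0" "\<And>k. 0 < k \<Longrightarrow> k < d2 \<Longrightarrow>
          \<bar>integral {- t..- t + k} (\<lambda>x. h (- x)) / k - h (- (- t))\<bar> < e"
        using N2(2)[OF t(2) \<open>0 < e\<close>] by blast
      show "\<exists>d>0. \<forall>k. k \<noteq> 0 \<and> dist k 0 < d \<longrightarrow> dist ((p (t + k) - p t) / k) (Q t * g (v t)) < e"
      proof (intro exI[of _ "min d1 d2"] conjI allI impI)
        fix k :: real assume k: "k \<noteq> 0 \<and> dist k 0 < min d1 d2"
        have "\<bar>(p (t + k) - p t) / k - h t\<bar> < e"
        proof (cases "0 < k")
          case True
          then show ?thesis using d1(2)[of k] k int(1)[of t "t + k"] by simp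
        next
          case False
          then have "k < 0" using k by simp
          have "integral {- t..- t + - k} (\<lambda>x. h (- x)) = p t - p (t + k)"
            using Henstock_Kurzweil_Integration.integral_reflect_real[of t "t + k" h] int(1)[of "t + k" t] \<open>k < 0\<close> by simp
          then have "\<bar>(p t - p (t + k)) / (- k) - h t\<bar> < e"
            using d2(2)[of "- k"] k \<open>k < 0\<close> by simp
          moreover have "(p t - p (t + k)) / (- k) = (p (t + k) - p t) / k"
            using \<open>k < 0\<close> by (simp add: field_simps)
          ultimately show ?thesis by simp
        qed
        then show "dist ((p (t + k) - p t) / k) (Q t * g (v t)) < e"
          by (simp add: dist_real_def h_def)
      qed (use d1(1) d2(1) in auto)
    qed
  qed
qed

end

subsection \<open>Monotonicity along the flow\<close>

context relativistic_system
begin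

lemma flow_increasing:
  assumes "flow Q g v p" "s < t" "\<And>r. s < r \<Longrightarrow> r < t \<Longrightarrow> 0 < p r"
  shows "v s < v t"
  by (rule DERIV_pos_imp_increasing_open[OF assms(2)])
    (use flow_DERIV[OF assms(1)] assms(3) psi_pos continuous_on_flow[OF assms(1)] in auto)

lemma flow_growth:
  assumes "flow Q g v p" "s \<le> t" "\<And>r. s \<le> r \<Longrightarrow> r \<le> t \<Longrightarrow> b \<le> p r"
  shows "psi b * (t - s) \<le> v t - v s"
proof -
  have "v s - psi b * s \<le> v t - psi b * t"
  proof (rule DERIV_nonneg_imp_nondecreasing[OF assms(2)])
    fix r assume "s \<le> r" "r \<le> t"
    have "((\<lambda>r. v r - psi b * r) has_real_derivative psi (p r) - psi b) (at r)"
      by (auto intro!: derivative_eq_intros flow_DERIV[OF assms(1)])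
    moreover have "0 \<le> psi (p r) - psi b"
      using psi_mono[OF assms(3)[OF \<open>s \<le> r\<close> \<open>r \<le> t\<close>]] by simp
    ultimately show "\<exists>y. ((\<lambda>r. v r - psi b * r) has_real_derivative y) (at r) \<and> 0 \<le> y"
      by blast
  qed
  then show ?thesis by (simp add: algebra_simps)
qed

lemma flow_momentum_growth:
  assumes "flow Q g v p" "s \<le> t" "0 \<le> b" "\<And>r. r \<in> {s..t} \<Longrightarrow> b \<le> g (v r)"
  shows "m * b * (t - s) \<le> p t - p s"
proof -
  have "((\<lambda>_. m * b) has_integral m * b * (t - s)) {s..t}"
    using has_integral_const_real[of "m * b" s t] assms(2) by (simp add: mult.commute)
  moreover have "m * b \<le> Q r * g (v r)" if "r \<in> {s..t}" for r
    using that assms(3,4) Q_ge[of r] m_pos by (intro mult_mono) auto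
  ultimately show ?thesis
    using has_integral_le[OF _ flow_integral[OF assms(1,2)]] by blast
qed

lemma DERIV_integral_of_force:
  assumes "flow Q g v p" "a < r"
  shows "((\<lambda>x. integral {a..x} (\<lambda>r. g (v r))) has_real_derivative g (v r)) (at r)"
proof -
  have "continuous_on {a..r + 1} (\<lambda>r. g (v r))"
    using continuous_on_compose2[OF continuous_on_g continuous_on_flow(1)[OF assms(1)]] by auto
  from integral_has_real_derivative[OF this, of r] assms(2) show ?thesis
    by (simp add: at_within_Icc_at)
qed

end

text \<open>The weight at \<open>t0\<close> itself is irrelevant; counting it with the left half-line gives the lower bound
  \<open>\<eta>\<close> on a closed interval.\<close>

locale bistable_step = relativistic_system +
  fixes U :: "real \<Rightarrow> real" and t0 \<eta> c \<alpha> :: real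
  assumes \<alpha>: "0 < \<alpha>" "\<alpha> < 1" and \<eta>_pos: "0 < \<eta>" and c_pos: "0 < c"
    and Q_before: "t \<le> t0 \<Longrightarrow> \<eta> \<le> Q t" and Q_after: "t0 < t \<Longrightarrow> Q t = c"
    and g_zero: "g 0 = 0" "g 1 = 0" and g_pos: "x \<in> {0<..<\<alpha>} \<Longrightarrow> 0 < g x"
    and U_zero: "U 0 = 0" and U_less: "x \<in> {0..<1} \<Longrightarrow> U x < U 1"
    and DERIV_U: "x \<in> {0..1} \<Longrightarrow> (U has_real_derivative - g x) (at x)"
    and threshold: "c * (U 1 - U \<alpha>) + \<eta> * U \<alpha> \<le> 0"
begin

lemma g_nonneg: "x \<in> {0..\<alpha>} \<Longrightarrow> 0 \<le> g x"
proof -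
  assume "x \<in> {0..\<alpha>}"
  then have "x \<in> closure {0<..<\<alpha>}"
    using \<alpha> by simp
  then show ?thesis
    by (rule continuous_ge_on_closure[OF continuous_on_g]) (use g_pos in \<open>auto intro: less_imp_le\<close>)
qed

lemma U_nonpos: "x \<in> {0..\<alpha>} \<Longrightarrow> U x \<le> 0"
proof -
  assume x: "x \<in> {0..\<alpha>}"
  have "U x \<le> U 0"
  proof (rule DERIV_nonpos_imp_nonincreasing[where f = U])
    show "\<exists>y. (U has_real_derivative y) (at z) \<and> y \<le> 0" if "0 \<le> z" "z \<le> x" for z
      using that x \<alpha> DERIV_U[of z] g_nonneg[of z] by (intro exI[of _ "- g z"]) auto
  qed (use x in auto)
  then show ?thesis by (simp add: U_zero)
qed

lemma continuous_on_U: "continuous_on {0..1} U"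
  by (rule DERIV_continuous_on[OF has_field_derivative_at_within[OF DERIV_U]])

text \<open>The graph of \<open>stable_momentum\<close> is the part with positive momentum of the level set of the energy
  \<open>sqrt (1 + p\<^sup>2) + c U(v)\<close> through the equilibrium \<open>(1, 0)\<close>.\<close>

definition stable_momentum :: "real \<Rightarrow> real" where
  "stable_momentum a = sqrt ((1 + c * (U 1 - U a))\<^sup>2 - 1)"

lemma
  assumes "a \<in> {0..<1}"
  shows stable_pos: "0 < stable_momentum a"
    and sqrt_stable: "sqrt (1 + (stable_momentum a)\<^sup>2) = 1 + c * (U 1 - U a)"
proof -
  have "0 < c * (U 1 - U a)"
    using U_less[OF assms] c_pos by simp
  then have "1 < (1 + c * (U 1 - U a))\<^sup>2"
    by (intro one_less_power) auto
  then show "0 < stable_momentum a" "sqrt (1 + (stable_momentum a)\<^sup>2) = 1 + c * (U 1 - U a)"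
    using \<open>0 < c * (U 1 - U a)\<close> by (simp_all add: stable_momentum_def)
qed

lemma continuous_on_stable: "continuous_on {0..1} stable_momentum"
  unfolding stable_momentum_def by (intro continuous_intros continuous_on_U)

text \<open>On [0, \<alpha>] the potential is largest at 0, so the level set is lowest there. This
  bounds the initial momentum from below uniformly in \<open>a\<close>.\<close>

lemma stable_ge: "a \<in> {0..\<alpha>} \<Longrightarrow> stable_momentum 0 \<le> stable_momentum a"
proof -
  assume a: "a \<in> {0..\<alpha>}"
  have "0 \<le> c * (U 1 - U 0)" "c * (U 1 - U 0) \<le> c * (U 1 - U a)"
    using U_less[of 0] U_nonpos[OF a] U_zero c_pos by (auto intro: mult_left_mono)
  then show ?thesis
    unfolding stable_momentum_def by (intro real_sqrt_le_mono diff_right_mono power_mono) auto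
qed

subsection \<open>The half-line with constant weight\<close>

text \<open>To the right of \<open>t0\<close> the weight is constant and the force continuous, so
  the derivative exists at every time; the weight at \<open>t0\<close> is discarded as a single
  point.\<close>

lemma DERIV_momentum_forward:
  assumes "flow Q g v p" "t0 < r"
  shows "(p has_real_derivative c * g (v r)) (at r)"
proof -
  have "p x = p t0 + c * integral {t0..x} (\<lambda>r. g (v r))" if "t0 < x" for x
  proof -
    have "((\<lambda>r. c * g (v r)) has_integral p x - p t0) {t0..x}"
      by (rule has_integral_spike_finite[of "{t0}", OF _ _ flow_integral[OF assms(1)]])
        (use that Q_after in auto)
    then show ?thesis by (simp add: integral_unique flip: integral_mult_right)
  qed
  moreover have "\<forall>\<^sub>F x in nhds r. x \<in> {t0<..}"
    using assms(2) by (intro eventually_nhds_in_open) auto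
  ultimately have "\<forall>\<^sub>F x in nhds r. p x = p t0 + c * integral {t0..x} (\<lambda>r. g (v r))"
    by (auto elim: eventually_mono)
  moreover have "((\<lambda>x. p t0 + c * integral {t0..x} (\<lambda>r. g (v r))) has_real_derivative c * g (v r)) (at r)"
    using DERIV_integral_of_force[OF assms] by (auto intro!: derivative_eq_intros)
  ultimately show ?thesis
    by (subst DERIV_cong_ev[OF refl _ refl])
qed

text \<open>What the kinetic term gains is exactly what the potential term loses. Only interior
  derivatives are used, since \<open>p\<close> may fail to be differentiable at
  \<open>t0\<close>.\<close>

lemma energy_conservation:
  assumes "flow Q g v p" "v t0 = a" "p t0 = stable_momentum a" "a \<in> {0..<1}" "t0 \<le> t"
    and "\<And>r. t0 \<le> r \<Longrightarrow> r \<le> t \<Longrightarrow> v r \<in> {0..1}"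
  shows "sqrt (1 + (p t)\<^sup>2) = 1 + c * (U 1 - U (v t))"
proof (cases "t = t0")
  case False
  then have "t0 < t" using assms(5) by simp
  define H where "H r = sqrt (1 + (p r)\<^sup>2) + c * U (v r)" for r
  have "continuous_on {t0..t} (\<lambda>r. U (v r))"
    by (rule continuous_on_compose2[OF continuous_on_U continuous_on_flow(1)[OF assms(1)]])
      (use assms(6) in auto)
  then have cont: "continuous_on {t0..t} H"
    unfolding H_def by (intro continuous_intros continuous_on_flow[OF assms(1)])
  have "H t = H t0"
  proof (rule DERIV_isconst_end[OF \<open>t0 < t\<close> cont])
    fix r assume r: "t0 < r" "r < t"
    have 1: "((\<lambda>r. sqrt (1 + (p r)\<^sup>2)) has_real_derivative psi (p r) * (c * g (v r))) (at r)"
      by (rule DERIV_chain2[OF DERIV_sqrt_one_plus_square DERIV_momentum_forward[OF assms(1) r(1)]])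
    have 2: "((\<lambda>r. U (v r)) has_real_derivative - g (v r) * psi (p r)) (at r)"
      by (rule DERIV_chain2[OF DERIV_U flow_DERIV[OF assms(1)]]) (use r assms(6) in auto)
    show "(H has_real_derivative 0) (at r)"
      unfolding H_def by (rule derivative_eq_intros 1 2 refl)+ simp
  qed
  moreover have "H t0 = 1 + c * U 1"
    unfolding H_def assms(2,3) sqrt_stable[OF assms(4)] by (simp add: algebra_simps)
  ultimately show ?thesis by (simp add: H_def algebra_simps)
qed (use assms sqrt_stable in simp)

text \<open>At a first time of leaving the region, the energy forces the point (1, 0):
  \<open>v = 1\<close> gives \<open>p = 0\<close>, while \<open>p = 0\<close> gives
  \<open>U v = U 1\<close> and so \<open>v = 1\<close>. An equilibrium cannot be reached in finite
  time.\<close>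

lemma forward_invariant:
  assumes "flow Q g v p" "v t0 = a" "p t0 = stable_momentum a" "a \<in> {0<..<1}" "t0 \<le> t"
  shows "0 < p t" "v t \<in> {a..<1}"
proof -
  note cont = continuous_on_flow[OF assms(1), of UNIV]
  define Bad where "Bad = {t. t0 \<le> t \<and> (1 \<le> v t \<or> p t \<le> 0)}"
  have "Bad = {t0..} \<inter> ({t. 1 \<le> v t} \<union> {t. p t \<le> 0})"
    by (auto simp: Bad_def)
  then have closed: "closed Bad"
    using cont by (auto intro!: closed_Collect_le closed_Int closed_Un continuous_on_const)
  have "Bad = {}"
  proof (rule ccontr)
    assume "Bad \<noteq> {}"
    moreover have bdd: "bdd_below Bad" by (rule bdd_belowI[of _ t0]) (auto simp: Bad_def)
    ultimately have "Inf Bad \<in> Bad" using closed by (rule closed_contains_Inf)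
    define s where "s = Inf Bad"
    have s: "t0 \<le> s" "1 \<le> v s \<or> p s \<le> 0"
      using \<open>Inf Bad \<in> Bad\<close> by (auto simp: Bad_def s_def)
    have before: "v r < 1 \<and> 0 < p r" if "t0 \<le> r" "r < s" for r
      using that cInf_lower[OF _ bdd, of r] by (force simp: Bad_def s_def)
    have "t0 \<noteq> s"
      using s(2) assms stable_pos[of a] by auto
    then have "t0 < s" using s by simp
    have "closure {t0<..<s} = {t0..s}" using \<open>t0 < s\<close> by simp
    then have "s \<in> closure {t0<..<s}" using \<open>t0 < s\<close> by simp
    then have "v s \<le> 1" "0 \<le> p s"
      using continuous_le_on_closure[OF continuous_on_flow(1)[OF assms(1)], of s "{t0<..<s}" 1]
        continuous_ge_on_closure[OF continuous_on_flow(2)[OF assms(1)], of s "{t0<..<s}" 0]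
        before by (force intro: less_imp_le)+
    moreover have above: "a \<le> v r" if "t0 \<le> r" "r \<le> s" for r
      using flow_increasing[OF assms(1), of t0 r] before that assms(2)
      by (cases "t0 = r") (auto intro: less_imp_le)
    moreover have "v r \<in> {0..1}" if "t0 \<le> r" "r \<le> s" for r
      using above[OF that] before[of r] that \<open>v s \<le> 1\<close> assms(4) by (cases "r = s") auto
    ultimately have energy: "sqrt (1 + (p s)\<^sup>2) = 1 + c * (U 1 - U (v s))"
      using energy_conservation[OF assms(1-3)] assms(4) s(1) by auto
    have "v s = 1 \<and> p s = 0"
    proof (cases "v s = 1")
      case True
      then show ?thesis using energy by (simp add: real_sqrt_eq_iff)
    next
      case False
      then have "p s = 0" using s(2) \<open>v s \<le> 1\<close> \<open>0 \<le> p s\<close> by auto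
      then have "U (v s) = U 1" using energy c_pos by simp
      then show ?thesis
        using U_less[of "v s"] above[of s] s(1) assms(4) \<open>v s \<le> 1\<close> False by auto
    qed
    then have "v t0 = 1"
      using flow_equilibrium_unique[OF assms(1) g_zero(2), of s t0] by simp
    then show False using assms(2,4) by simp
  qed
  then have good: "v r < 1 \<and> 0 < p r" if "t0 \<le> r" for r
    using that by (force simp: Bad_def)
  show "0 < p t" using good assms(5) by simp
  have "a \<le> v t"
    using flow_increasing[OF assms(1), of t0 t] good assms(2,5)
    by (cases "t0 = t") (auto intro: less_imp_le)
  then show "v t \<in> {a..<1}" using good assms(5) by simp
qed

text \<open>If \<open>v\<close> stayed below some \<open>x < 1\<close>, the orbit would follow a
  compact piece of the level set on which the momentum has a positive minimum, and \<open>v\<close>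
  would grow linearly.\<close>

lemma forward_limit:
  assumes "flow Q g v p" "v t0 = a" "p t0 = stable_momentum a" "a \<in> {0<..<1}"
  shows "(v \<longlongrightarrow> 1) at_top"
proof (rule increasing_tendsto)
  note inv = forward_invariant[OF assms]
  show "\<forall>\<^sub>F t in at_top. v t \<le> 1"
    using eventually_ge_at_top[of t0] by eventually_elim (use inv(2) in \<open>auto intro: less_imp_le\<close>)
  fix x :: real assume "x < 1"
  have "\<exists>t\<ge>t0. x < v t"
  proof (rule ccontr)
    assume "\<not> ?thesis"
    then have le: "v t \<le> x" if "t0 \<le> t" for t using that by force
    have "{a..x} \<noteq> {}" using le[of t0] assms(2) by simp
    moreover have "continuous_on {a..x} stable_momentum"
      by (rule continuous_on_subset[OF continuous_on_stable]) (use assms(4) \<open>x < 1\<close> in auto)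
    ultimately obtain z where z: "z \<in> {a..x}" "\<And>y. y \<in> {a..x} \<Longrightarrow> stable_momentum z \<le> stable_momentum y"
      using continuous_attains_inf[of "{a..x}" stable_momentum] by auto
    have "stable_momentum z \<le> p t" if "t0 \<le> t" for t
    proof -
      have "sqrt (1 + (p t)\<^sup>2) = 1 + c * (U 1 - U (v t))"
        by (rule energy_conservation[OF assms(1-3) _ that]) (use assms(4) inv(2) in force)+
      also have "\<dots> = sqrt (1 + (stable_momentum (v t))\<^sup>2)"
        using sqrt_stable[of "v t"] inv(2)[OF that] assms(4) by auto
      finally have "(p t)\<^sup>2 = (stable_momentum (v t))\<^sup>2" by simp
      then have "p t = stable_momentum (v t)"
        using inv[OF that] stable_pos[of "v t"] assms(4) by (auto simp: power2_eq_iff)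
      then show ?thesis using z(2)[of "v t"] inv(2)[OF that] le[OF that] by simp
    qed
    moreover have pos: "0 < psi (stable_momentum z)"
      using stable_pos[of z] z(1) assms(4) \<open>x < 1\<close> by (intro psi_pos) auto
    \<comment> \<open>At the minimal speed this time suffices to cover a distance 1, more than the
      room left above \<open>a > 0\<close>.\<close>
    ultimately have "psi (stable_momentum z) * (1 / psi (stable_momentum z)) \<le> v (t0 + 1 / psi (stable_momentum z)) - v t0"
      using flow_growth[OF assms(1), of t0 "t0 + 1 / psi (stable_momentum z)" "stable_momentum z"] by auto
    then have "1 \<le> v (t0 + 1 / psi (stable_momentum z)) - v t0" using pos by simp
    moreover have "v (t0 + 1 / psi (stable_momentum z)) < 1"
      using inv(2)[of "t0 + 1 / psi (stable_momentum z)"] pos by simp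
    ultimately show False using assms(2,4) by simp
  qed
  then obtain t where t: "t0 \<le> t" "x < v t" by blast
  have "x < v s" if "t \<le> s" for s
    using flow_increasing[OF assms(1), of t s] inv(1) t that by (cases "s = t") force+
  then show "\<forall>\<^sub>F t in at_top. x < v t"
    unfolding eventually_at_top_linorder by blast
qed

end

subsection \<open>Shooting backwards\<close>

lemma continuous_greater_near:
  fixes h :: "real \<Rightarrow> real"
  assumes "continuous_on UNIV h" "y < h s"
  obtains e where "0 < e" "\<And>r. \<bar>r - s\<bar> < e \<Longrightarrow> y < h r"
proof -
  obtain e where e: "0 < e" "\<forall>r. dist r s < e \<longrightarrow> dist (h r) (h s) < h s - y"
    using assms unfolding continuous_on_iff by (metis UNIV_I diff_gt_0_iff_gt)
  show thesis
    by (rule that[OF e(1)]) (use e(2) in \<open>force simp: dist_real_def\<close>)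
qed

lemma continuous_positive_lower_bound:
  fixes h :: "real \<Rightarrow> real"
  assumes "continuous_on UNIV h" "\<And>r. r \<in> {s..t} \<Longrightarrow> 0 < h r"
  obtains \<mu> where "0 < \<mu>" "\<And>r. r \<in> {s..t} \<Longrightarrow> \<mu> \<le> h r"
proof (cases "s \<le> t")
  case True
  have "continuous_on {s..t} h"
    by (rule continuous_on_subset[OF assms(1)]) simp
  then obtain x where "x \<in> {s..t}" "\<And>r. r \<in> {s..t} \<Longrightarrow> h x \<le> h r"
    using continuous_attains_inf[of "{s..t}" h] True by auto
  then show thesis using that[of "h x"] assms(2) by blast
qed (use that[of 1] in simp)

context bistable_step
begin

text \<open>On the left half-line the weight is at least \<open>\<eta>\<close>, so lowering it to \<open>\<eta>\<close> along the given \<open>v\<close> yields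
  a larger momentum \<open>P\<close>. Unlike \<open>p\<close> it is continuously differentiable, so that its energy with weight
  \<open>\<eta>\<close> can be differentiated.\<close>

lemma no_overshoot:
  assumes "flow Q g v p" "v t0 = \<alpha>" "p t0 = stable_momentum \<alpha>"
    and "s < t0" "v s < 0" and pos: "\<And>r. r \<in> {s..t0} \<Longrightarrow> 0 < p r"
  shows False
proof -
  note cont = continuous_on_flow[OF assms(1)]
  \<comment> \<open>The orbit crosses 0 at \<open>s1\<close>; between \<open>s1\<close> and
    \<open>t0\<close> it stays in [0, \<alpha>], where the sign of \<open>g\<close> is
    known.\<close>
  obtain s1 where s1: "s \<le> s1" "s1 \<le> t0" "v s1 = 0"
    using IVT'[of v s 0 t0] cont assms \<alpha> by auto
  then have "s1 < t0" using assms(2) \<alpha> by (cases "s1 = t0") auto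
  have v: "v r \<in> {0..\<alpha>}" if "s1 \<le> r" "r \<le> t0" for r
  proof -
    have "v s1 \<le> v r" "v r \<le> v t0"
      using flow_increasing[OF assms(1), of s1 r] flow_increasing[OF assms(1), of r t0] pos that s1
      by (cases "s1 = r"; cases "r = t0"; force)+
    then show ?thesis using s1(3) assms(2) by simp
  qed
  define J where "J r = integral {s1..r} (\<lambda>r. g (v r))" for r
  define P where "P r = p t0 - \<eta> * (J t0 - J r)" for r
  have cont_gv: "continuous_on S (\<lambda>r. g (v r))" for S
    by (rule continuous_on_compose2[OF continuous_on_g cont(1)]) auto
  have int: "(\<lambda>r. g (v r)) integrable_on {x..y}" for x y
    by (rule integrable_continuous_real[OF cont_gv])
  have P_ge: "p r \<le> P r" if "s1 \<le> r" "r \<le> t0" for r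
  proof -
    have "J t0 - J r = integral {r..t0} (\<lambda>r. g (v r))"
      using Henstock_Kurzweil_Integration.integral_combine[OF that int] by (simp add: J_def)
    then have "((\<lambda>r. \<eta> * g (v r)) has_integral \<eta> * (J t0 - J r)) {r..t0}"
      using has_integral_mult_right[OF integrable_integral[OF int]] by simp
    then have "\<eta> * (J t0 - J r) \<le> p t0 - p r"
      by (rule has_integral_le[OF _ flow_integral[OF assms(1) that(2)]])
        (use g_nonneg v that Q_before in \<open>auto intro!: mult_right_mono\<close>)
    then show ?thesis by (simp add: P_def)
  qed
  have cont_J: "continuous_on {s1..t0} J"
    unfolding J_def by (rule indefinite_integral_continuous_1[OF int])
  define H where "H r = sqrt (1 + (P r)\<^sup>2) + \<eta> * U (v r)" for r
  \<comment> \<open>The derivative of \<open>H\<close> is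
    \<open>\<eta> * g (v r) * (psi (P r) - psi (p r)) \<ge> 0\<close>. The contradiction:
    \<open>H s1\<close> is a kinetic term with \<open>P s1 > 0\<close>, hence exceeds 1, whereas
    \<open>threshold\<close> gives \<open>H t0 \<le> 1\<close>.\<close>
  have "H s1 \<le> H t0"
  proof (rule DERIV_nonneg_imp_increasing_open[where f = H])
    show "s1 \<le> t0" using s1 by simp
    have "continuous_on {s1..t0} (\<lambda>r. U (v r))"
      by (rule continuous_on_compose2[OF continuous_on_U cont(1)]) (use v \<alpha> in force)
    then show "continuous_on {s1..t0} H"
      unfolding H_def P_def by (intro continuous_intros cont_J)
    fix r assume r: "s1 < r" "r < t0"
    have 0: "(P has_real_derivative \<eta> * g (v r)) (at r)"
      unfolding P_def
      by (rule derivative_eq_intros DERIV_integral_of_force[OF assms(1) r(1), folded J_def] refl)+ simp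
    have 1: "((\<lambda>r. sqrt (1 + (P r)\<^sup>2)) has_real_derivative psi (P r) * (\<eta> * g (v r))) (at r)"
      by (rule DERIV_chain2[OF DERIV_sqrt_one_plus_square 0])
    have 2: "((\<lambda>r. U (v r)) has_real_derivative - g (v r) * psi (p r)) (at r)"
      by (rule DERIV_chain2[OF DERIV_U flow_DERIV[OF assms(1)]]) (use r v[of r] \<alpha> in auto)
    have "(H has_real_derivative \<eta> * g (v r) * (psi (P r) - psi (p r))) (at r)"
      unfolding H_def by (rule derivative_eq_intros 1 2 refl)+ (simp add: algebra_simps)
    moreover have "0 \<le> \<eta> * g (v r) * (psi (P r) - psi (p r))"
      using psi_mono[OF P_ge[of r]] g_nonneg[OF v[of r]] r \<eta>_pos by simp
    ultimately show "\<exists>y. (H has_real_derivative y) (at r) \<and> 0 \<le> y" by blast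
  qed
  also have "H t0 = 1 + c * (U 1 - U \<alpha>) + \<eta> * U \<alpha>"
    using sqrt_stable[of \<alpha>] \<alpha> by (simp add: H_def P_def assms(2,3))
  also have "\<dots> \<le> 1" using threshold by simp
  finally have "sqrt (1 + (P s1)\<^sup>2) \<le> 1" by (simp add: H_def s1(3) U_zero)
  moreover have "0 < P s1" using P_ge[of s1] pos[of s1] s1 by simp
  ultimately show False by simp
qed

text \<open>The momentum starts at \<open>w\<close> or more and changes at rate at most
  \<open>K * B\<close>, so it stays above \<open>w / 2\<close> for a time independent of
  \<open>a\<close>; a small \<open>a\<close> is used up within it.\<close>

lemma early_exit:
  "\<exists>b>0. \<forall>v p a. flow Q g v p \<longrightarrow> v t0 = a \<longrightarrow> p t0 = stable_momentum a \<longrightarrow> a \<in> {0<..\<alpha>} \<longrightarrow> a < b \<longrightarrow>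
      (\<exists>s<t0. v s < 0 \<and> (\<forall>r\<in>{s..t0}. 0 < p r))"
proof -
  define w where "w = stable_momentum 0"
  \<comment> \<open>The added 1 keeps the denominator positive using only
    \<open>0 \<le> K * B\<close>.\<close>
  define \<tau> where "\<tau> = w / (2 * (K * B + 1))"
  have w: "0 < w" unfolding w_def by (rule stable_pos) auto
  have KB: "0 \<le> K * B" using K_pos B_nonneg by simp
  then have \<tau>: "0 < \<tau>" "K * B * \<tau> \<le> w / 2"
    using w by (simp_all add: \<tau>_def field_simps)
  show ?thesis
  proof (rule exI[of _ "psi (w / 2) * \<tau>"], intro conjI allI impI)
    show "0 < psi (w / 2) * \<tau>" using w \<tau> psi_pos[of "w / 2"] by simp
    fix v p a
    assume flow: "flow Q g v p" and init: "v t0 = a" "p t0 = stable_momentum a"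
      and a: "a \<in> {0<..\<alpha>}" "a < psi (w / 2) * \<tau>"
    have p: "w / 2 \<le> p r" if "r \<in> {t0 - \<tau>..t0}" for r
    proof -
      have "\<bar>p t0 - p r\<bar> \<le> K * B * \<bar>t0 - r\<bar>" by (rule flow_lipschitz[OF flow])
      also have "\<dots> \<le> K * B * \<tau>" using that KB by (intro mult_left_mono) auto
      finally have "\<bar>p t0 - p r\<bar> \<le> w / 2" using \<tau>(2) by simp
      moreover have "w \<le> p t0" using stable_ge[of a] a init by (simp add: w_def)
      ultimately show ?thesis by linarith
    qed
    have "psi (w / 2) * (t0 - (t0 - \<tau>)) \<le> v t0 - v (t0 - \<tau>)"
      using p \<tau>(1) by (intro flow_growth[OF flow]) auto
    then have "v (t0 - \<tau>) < 0" using a init by simp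
    then show "\<exists>s<t0. v s < 0 \<and> (\<forall>r\<in>{s..t0}. 0 < p r)"
      using \<tau>(1) p w by (intro exI[of _ "t0 - \<tau>"]) force
  qed
qed

text \<open>At the last bad time before \<open>t0\<close> the orbit touches the boundary of the
  quadrant. The corner is an equilibrium and cannot be met; on either open edge the field pushes the
  orbit across just before, giving one of the excluded exits.\<close>

lemma backward_alternative:
  assumes "flow Q g v p" "v t0 = a" "p t0 = stable_momentum a" "a \<in> {0<..\<alpha>}"
    and no_turn: "\<nexists>s. s < t0 \<and> p s < 0 \<and> (\<forall>r\<in>{s..t0}. 0 < v r)"
    and no_exit: "\<nexists>s. s < t0 \<and> v s < 0 \<and> (\<forall>r\<in>{s..t0}. 0 < p r)"
    and "t \<le> t0"
  shows "0 < v t \<and> 0 < p t"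
proof -
  note cont = continuous_on_flow[OF assms(1)]
  define Bad where "Bad = {t. t \<le> t0 \<and> (v t \<le> 0 \<or> p t \<le> 0)}"
  have "Bad = {..t0} \<inter> ({t. v t \<le> 0} \<union> {t. p t \<le> 0})"
    by (auto simp: Bad_def)
  then have closed: "closed Bad"
    using cont by (auto intro!: closed_Collect_le closed_Int closed_Un continuous_on_const)
  have "Bad = {}"
  proof (rule ccontr)
    assume "Bad \<noteq> {}"
    moreover have bdd: "bdd_above Bad" by (rule bdd_aboveI[of _ t0]) (auto simp: Bad_def)
    ultimately have "Sup Bad \<in> Bad" using closed by (rule closed_contains_Sup)
    define s where "s = Sup Bad"
    have s: "s \<le> t0" "v s \<le> 0 \<or> p s \<le> 0"
      using \<open>Sup Bad \<in> Bad\<close> by (auto simp: Bad_def s_def)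
    have after: "0 < v r \<and> 0 < p r" if "s < r" "r \<le> t0" for r
      using that cSup_upper[OF _ bdd, of r] by (force simp: Bad_def s_def)
    have "s \<noteq> t0" using s(2) assms(2-4) stable_pos[of a] \<alpha> by auto
    then have "s < t0" using s by simp
    then have cl: "s \<in> closure {s<..<t0}" by simp
    have "0 \<le> v s" "0 \<le> p s"
      using continuous_ge_on_closure[OF cont(1) cl, of 0] continuous_ge_on_closure[OF cont(2) cl, of 0] after
      by (force intro: less_imp_le)+
    then consider "v s = 0" "p s = 0" | "v s = 0" "0 < p s" | "0 < v s" "p s = 0"
      using s(2) by linarith
    then show False
    proof cases
      case 1
      then have "v t0 = 0" using flow_equilibrium_unique[OF assms(1) g_zero(1), of s t0] by simp
      then show False using assms(2,4) by simp
    next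
      case 2
      then obtain e where e: "0 < e" "\<And>r. \<bar>r - s\<bar> < e \<Longrightarrow> 0 < p r"
        using continuous_greater_near[OF cont(2)] by blast
      have "v (s - e / 2) < v s"
        using e by (intro flow_increasing[OF assms(1)]) auto
      moreover have "0 < p r" if "s - e / 2 \<le> r" "r \<le> t0" for r
        using e(1) e(2)[of r] after[of r] that by (cases "s < r") auto
      ultimately show False
        using no_exit 2(1) \<open>s < t0\<close> e(1) by (auto dest!: spec[of _ "s - e / 2"])
    next
      case 3
      \<comment> \<open>Strictness comes from the positive momentum on ]s, t0[ and ensures that the
        force at \<open>s\<close> is positive, so \<open>p\<close> was negative just before.\<close>
      have "v s < \<alpha>"
        using flow_increasing[OF assms(1) \<open>s < t0\<close>] after assms(2,4) by auto
      then have "0 < g (v s)" using g_pos 3 by simp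
      have "continuous_on UNIV (\<lambda>r. g (v r))"
        by (rule continuous_on_compose2[OF continuous_on_g cont(1)]) auto
      then obtain e1 where e1: "0 < e1" "\<And>r. \<bar>r - s\<bar> < e1 \<Longrightarrow> g (v s) / 2 < g (v r)"
        using continuous_greater_near[of "\<lambda>r. g (v r)" "g (v s) / 2" s] \<open>0 < g (v s)\<close> by auto
      obtain e2 where e2: "0 < e2" "\<And>r. \<bar>r - s\<bar> < e2 \<Longrightarrow> 0 < v r"
        using continuous_greater_near[OF cont(1) 3(1)] by blast
      define e where "e = min e1 e2"
      have e: "0 < e" "\<And>r. \<bar>r - s\<bar> < e \<Longrightarrow> g (v s) / 2 < g (v r) \<and> 0 < v r"
        using e1 e2 by (auto simp: e_def)
      have "m * (g (v s) / 2) * (s - (s - e / 2)) \<le> p s - p (s - e / 2)"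
        using e \<open>0 < g (v s)\<close> by (intro flow_momentum_growth[OF assms(1)]) (auto intro: less_imp_le)
      moreover have "0 < m * (g (v s) / 2) * (s - (s - e / 2))"
        using m_pos e(1) \<open>0 < g (v s)\<close> by simp
      ultimately have "p (s - e / 2) < 0" using 3(2) by simp
      moreover have "0 < v r" if "s - e / 2 \<le> r" "r \<le> t0" for r
        using e(1) e(2)[of r] after[of r] that by (cases "s < r") auto
      ultimately show False
        using no_turn \<open>s < t0\<close> e(1) by (auto dest!: spec[of _ "s - e / 2"])
    qed
  qed
  then show ?thesis using \<open>t \<le> t0\<close> by (force simp: Bad_def)
qed

text \<open>If \<open>v\<close> stayed above some \<open>x > 0\<close>, the force would have a
  positive lower bound in the past and the momentum, decreasing linearly backwards, could not stay
  positive.\<close>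

lemma backward_limit:
  assumes "flow Q g v p" "v t0 = a" "a \<in> {0<..\<alpha>}"
    and pos: "\<And>t. t \<le> t0 \<Longrightarrow> 0 < v t \<and> 0 < p t"
  shows "(v \<longlongrightarrow> 0) at_bot"
proof (rule decreasing_tendsto)
  show "\<forall>\<^sub>F t in at_bot. 0 \<le> v t"
    using eventually_le_at_bot[of t0] by eventually_elim (use pos in \<open>auto intro: less_imp_le\<close>)
  fix x :: real assume "0 < x"
  define t1 where "t1 = t0 - 1"
  have incr: "v s < v t" if "s < t" "t \<le> t0" for s t
    using flow_increasing[OF assms(1) that(1)] pos that by auto
  have "v t1 < \<alpha>" using incr[of t1 t0] assms(2,3) by (simp add: t1_def)
  have "\<exists>t\<le>t1. v t < x"
  proof (rule ccontr)
    assume "\<not> ?thesis"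
    then have range: "v t \<in> {x..v t1}" if "t \<le> t1" for t
      using that incr[of t t1] by (cases "t = t1") (auto simp: t1_def not_less)
    obtain z where z: "z \<in> {x..v t1}" "\<And>y. y \<in> {x..v t1} \<Longrightarrow> g z \<le> g y"
      using continuous_attains_inf[of "{x..v t1}" g] continuous_on_g range[of t1] by auto
    have "0 < g z" using z(1) \<open>0 < x\<close> \<open>v t1 < \<alpha>\<close> by (intro g_pos) auto
    then have "0 < m * g z" using m_pos by simp
    \<comment> \<open>The time by which a force of at least \<open>m * g z\<close> has used up the
      whole momentum \<open>p t1\<close>.\<close>
    define s where "s = t1 - p t1 / (m * g z)"
    have "s \<le> t1" using pos[of t1] \<open>0 < m * g z\<close> by (simp add: s_def t1_def)
    have "m * g z * (t1 - s) \<le> p t1 - p s"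
      using z(2) range \<open>0 < g z\<close> by (intro flow_momentum_growth[OF assms(1) \<open>s \<le> t1\<close>]) auto
    moreover have "m * g z * (t1 - s) = p t1"
      using m_pos \<open>0 < g z\<close> by (simp add: s_def)
    ultimately have "p s \<le> 0" by simp
    then show False using pos[of s] \<open>s \<le> t1\<close> by (simp add: t1_def)
  qed
  then obtain t where t: "t \<le> t1" "v t < x" by blast
  have "v s < x" if "s \<le> t" for s
    using incr[of s t] t that by (cases "s = t") (auto simp: t1_def)
  then show "\<forall>\<^sub>F t in at_bot. v t < x"
    unfolding eventually_at_bot_linorder by blast
qed

lemma heteroclinic_flow:
  obtains v p where "flow Q g v p" "\<And>t. 0 < p t" "\<And>t. v t \<in> {0<..<1}"
    "(v \<longlongrightarrow> 0) at_bot" "(v \<longlongrightarrow> 1) at_top"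
proof -
  have "\<forall>a. \<exists>v p. flow Q g v p \<and> v t0 = a \<and> p t0 = stable_momentum a"
    using flow_exists by blast
  then obtain V W where VW: "flow Q g (V a) (W a)" "V a t0 = a" "W a t0 = stable_momentum a" for a
    by metis
  have near: "\<exists>d>0. \<forall>a'\<in>{0<..\<alpha>}. \<bar>a' - a\<bar> < d \<longrightarrow>
      (\<forall>t\<in>{s..t0}. \<bar>V a t - V a' t\<bar> < e \<and> \<bar>W a t - W a' t\<bar> < e)"
    if "a \<in> {0<..\<alpha>}" "0 < e" for a s e
  proof -
    \<comment> \<open>The largest Gronwall factor on \<open>{s..t0}\<close>. Initial position and
      initial momentum are each allowed half of the admissible gap \<open>e / E\<close>.\<close>
    define E where "E = exp ((1 + K * L) * \<bar>s - t0\<bar>)"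
    have "0 < E" by (simp add: E_def)
    then have "0 < e / (2 * E)" using that by simp
    moreover have "continuous_on {0<..\<alpha>} stable_momentum"
      by (rule continuous_on_subset[OF continuous_on_stable]) (use \<alpha> in auto)
    ultimately have "\<exists>d>0. \<forall>a'\<in>{0<..\<alpha>}. dist a' a < d \<longrightarrow>
        dist (stable_momentum a') (stable_momentum a) < e / (2 * E)"
      using that(1) unfolding continuous_on_iff by blast
    then obtain d where d: "0 < d" "\<And>a'. a' \<in> {0<..\<alpha>} \<Longrightarrow> dist a' a < d \<Longrightarrow>
        dist (stable_momentum a') (stable_momentum a) < e / (2 * E)"
      by blast
    show ?thesis
    proof (intro exI[of _ "min d (e / (2 * E))"] conjI ballI impI)
      fix a' t assume a': "a' \<in> {0<..\<alpha>}" "\<bar>a' - a\<bar> < min d (e / (2 * E))" and t: "t \<in> {s..t0}"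
      have gap0: "gap (V a) (W a) (V a') (W a') t0 < e / E"
        using d(2)[of a'] a' by (auto simp: gap_def VW dist_real_def abs_minus_commute)
      have "gap (V a) (W a) (V a') (W a') t
          \<le> gap (V a) (W a) (V a') (W a') t0 * exp ((1 + K * L) * \<bar>t - t0\<bar>)"
        by (rule gap_le[OF VW(1) VW(1)])
      also have "\<dots> \<le> gap (V a) (W a) (V a') (W a') t0 * E"
        unfolding E_def using t K_pos L_nonneg
        by (intro mult_left_mono) (auto simp: gap_def intro!: mult_left_mono)
      also have "\<dots> < e / E * E"
        using gap0 \<open>0 < E\<close> by (rule mult_strict_right_mono)
      finally have "gap (V a) (W a) (V a') (W a') t < e" using \<open>0 < E\<close> by simp
      then show "\<bar>V a t - V a' t\<bar> < e" "\<bar>W a t - W a' t\<bar> < e"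
        unfolding gap_def by linarith+
    qed (use d(1) \<open>0 < e / (2 * E)\<close> in auto)
  qed
  define X where "X = {a \<in> {0<..\<alpha>}. \<exists>s<t0. W a s < 0 \<and> (\<forall>r\<in>{s..t0}. 0 < V a r)}"
  define Y where "Y = {a \<in> {0<..\<alpha>}. \<exists>s<t0. V a s < 0 \<and> (\<forall>r\<in>{s..t0}. 0 < W a r)}"
  have open_X: "\<exists>d>0. \<forall>a'\<in>{0<..\<alpha>}. dist a' a < d \<longrightarrow> a' \<in> X" if aX: "a \<in> X" for a
  proof -
    obtain s where s: "a \<in> {0<..\<alpha>}" "s < t0" "W a s < 0" "\<forall>r\<in>{s..t0}. 0 < V a r"
      using aX unfolding X_def by blast
    \<comment> \<open>Compactness gives a margin for the condition on \<open>{s..t0}\<close>;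
      together with the margin \<open>- W a s\<close> at \<open>s\<close> it makes the same
      \<open>s\<close> work for all nearby \<open>a'\<close>.\<close>
    obtain \<mu> where \<mu>: "0 < \<mu>" "\<And>r. r \<in> {s..t0} \<Longrightarrow> \<mu> \<le> V a r"
      using continuous_positive_lower_bound[OF continuous_on_flow(1)[OF VW(1)]] s(4) by blast
    obtain d where d: "0 < d" "\<forall>a'\<in>{0<..\<alpha>}. \<bar>a' - a\<bar> < d \<longrightarrow>
        (\<forall>t\<in>{s..t0}. \<bar>V a t - V a' t\<bar> < min \<mu> (- W a s) \<and> \<bar>W a t - W a' t\<bar> < min \<mu> (- W a s))"
      using near[OF s(1), of "min \<mu> (- W a s)" s] \<mu>(1) s(3) by auto
    have "a' \<in> X" if a': "a' \<in> {0<..\<alpha>}" "\<bar>a' - a\<bar> < d" for a'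
    proof -
      have "W a' s < 0" using d(2)[rule_format, OF a', of s] s(2) by auto
      moreover have "0 < V a' r" if "r \<in> {s..t0}" for r
        using d(2)[rule_format, OF a' that] \<mu>(2)[OF that] by linarith
      ultimately show ?thesis using a'(1) s(2) by (auto simp: X_def)
    qed
    then show ?thesis using d(1) by (auto simp: dist_real_def)
  qed
  have open_Y: "\<exists>d>0. \<forall>a'\<in>{0<..\<alpha>}. dist a' a < d \<longrightarrow> a' \<in> Y" if aY: "a \<in> Y" for a
  proof -
    obtain s where s: "a \<in> {0<..\<alpha>}" "s < t0" "V a s < 0" "\<forall>r\<in>{s..t0}. 0 < W a r"
      using aY unfolding Y_def by blast
    obtain \<mu> where \<mu>: "0 < \<mu>" "\<And>r. r \<in> {s..t0} \<Longrightarrow> \<mu> \<le> W a r"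
      using continuous_positive_lower_bound[OF continuous_on_flow(2)[OF VW(1)]] s(4) by blast
    obtain d where d: "0 < d" "\<forall>a'\<in>{0<..\<alpha>}. \<bar>a' - a\<bar> < d \<longrightarrow>
        (\<forall>t\<in>{s..t0}. \<bar>V a t - V a' t\<bar> < min \<mu> (- V a s) \<and> \<bar>W a t - W a' t\<bar> < min \<mu> (- V a s))"
      using near[OF s(1), of "min \<mu> (- V a s)" s] \<mu>(1) s(3) by auto
    have "a' \<in> Y" if a': "a' \<in> {0<..\<alpha>}" "\<bar>a' - a\<bar> < d" for a'
    proof -
      have "V a' s < 0" using d(2)[rule_format, OF a', of s] s(2) by auto
      moreover have "0 < W a' r" if "r \<in> {s..t0}" for r
        using d(2)[rule_format, OF a' that] \<mu>(2)[OF that] by linarith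
      ultimately show ?thesis using a'(1) s(2) by (auto simp: Y_def)
    qed
    then show ?thesis using d(1) by (auto simp: dist_real_def)
  qed
  have "openin (top_of_set {0<..\<alpha>}) X" "openin (top_of_set {0<..\<alpha>}) Y"
    using open_X open_Y by (auto simp: openin_euclidean_subtopology_iff X_def Y_def)
  \<comment> \<open>At the later of the two witnesses, one condition makes a coordinate negative and
    the other makes it positive.\<close>
  moreover have "X \<inter> Y = {}"
  proof (rule ccontr)
    assume "X \<inter> Y \<noteq> {}"
    then obtain a s s' where "s < t0" "W a s < 0" "\<forall>r\<in>{s..t0}. 0 < V a r"
      "s' < t0" "V a s' < 0" "\<forall>r\<in>{s'..t0}. 0 < W a r"
      by (auto simp: X_def Y_def)
    then show False
      by (cases "s \<le> s'") (force dest: bspec[where x = s] bspec[where x = s'])+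
  qed
  moreover have "\<alpha> \<notin> Y"
    using no_overshoot[OF VW] unfolding Y_def by blast
  moreover have "Y \<noteq> {}"
  proof -
    obtain b where b: "0 < b" "\<forall>v p a. flow Q g v p \<longrightarrow> v t0 = a \<longrightarrow> p t0 = stable_momentum a \<longrightarrow>
        a \<in> {0<..\<alpha>} \<longrightarrow> a < b \<longrightarrow> (\<exists>s<t0. v s < 0 \<and> (\<forall>r\<in>{s..t0}. 0 < p r))"
      using early_exit by blast
    have "min (b / 2) \<alpha> \<in> Y"
      using b(2)[rule_format, OF VW, of "min (b / 2) \<alpha>"] b(1) \<alpha> unfolding Y_def by auto
    then show ?thesis by blast
  qed
  moreover have "connected {0<..\<alpha>}" by simp
  \<comment> \<open>If \<open>X\<close> and \<open>Y\<close> covered the interval, \<alpha> would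
    lie in \<open>X\<close>, and two disjoint nonempty relatively open sets would disconnect
    it.\<close>
  ultimately have "\<not> {0<..\<alpha>} \<subseteq> X \<union> Y"
    using \<alpha> unfolding connected_openin by (metis empty_iff Un_iff greaterThanAtMost_iff order_refl subsetD)
  then obtain a where a: "a \<in> {0<..\<alpha>}" "a \<notin> X" "a \<notin> Y" by blast
  then have a01: "a \<in> {0<..<1}" using \<alpha> by auto
  have past: "0 < V a t \<and> 0 < W a t" if "t \<le> t0" for t
    by (rule backward_alternative[OF VW a(1) _ _ that]) (use a in \<open>auto simp: X_def Y_def\<close>)
  note forw = forward_invariant[OF VW a01]
  show thesis
  proof (rule that[OF VW(1)[of a]])
    show pos: "0 < W a t" for t using past[of t] forw(1)[of t] by (cases "t \<le> t0") auto
    show "V a t \<in> {0<..<1}" for t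
    proof (cases "t0 \<le> t")
      case True then show ?thesis using forw(2)[of t] a(1) by auto
    next
      case False
      then have "V a t < V a t0" by (intro flow_increasing[OF VW(1)] pos) auto
      then show ?thesis using past[of t] False a01 by (simp add: VW)
    qed
    show "(V a \<longlongrightarrow> 0) at_bot" by (rule backward_limit[OF VW(1,2) a(1) past])
    show "(V a \<longlongrightarrow> 1) at_top" by (rule forward_limit[OF VW a01])
  qed
qed

end

subsection \<open>Construction of the heteroclinic solution\<close>

lemma absolutely_continuous_on_lipschitz:
  assumes "\<And>x y. \<bar>g y - g x\<bar> \<le> C * \<bar>y - x\<bar>"
  shows "absolutely_continuous_on S g"
  unfolding absolutely_continuous_on_def
proof (intro allI impI)
  fix e :: real assume "0 < e"
  \<comment> \<open>Raising the constant to at least 1 makes \<open>e / C'\<close> a positive choice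
    for any \<open>C\<close>.\<close>
  define C' where "C' = max 1 C"
  have C': "0 < C'" "\<bar>g y - g x\<bar> \<le> C' * \<bar>y - x\<bar>" for x y
    using order_trans[OF assms[of y x] mult_right_mono[of C C' "\<bar>y - x\<bar>"]] by (auto simp: C'_def)
  show "\<exists>d>0. \<forall>(n::nat) a b. (\<forall>i<n. a i \<le> b i \<and> {a i..b i} \<subseteq> S) \<and>
      disjoint_family_on (\<lambda>i. {a i<..<b i}) {..<n} \<and> (\<Sum>i<n. b i - a i) < d \<longrightarrow>
      (\<Sum>i<n. \<bar>g (b i) - g (a i)\<bar>) < e"
  proof (intro exI[of _ "e / C'"] conjI allI impI)
    fix n :: nat and a b :: "nat \<Rightarrow> real"
    assume *: "(\<forall>i<n. a i \<le> b i \<and> {a i..b i} \<subseteq> S) \<and>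
      disjoint_family_on (\<lambda>i. {a i<..<b i}) {..<n} \<and> (\<Sum>i<n. b i - a i) < e / C'"
    have "(\<Sum>i<n. \<bar>g (b i) - g (a i)\<bar>) \<le> (\<Sum>i<n. C' * (b i - a i))"
    proof (rule sum_mono)
      show "\<bar>g (b i) - g (a i)\<bar> \<le> C' * (b i - a i)" if "i \<in> {..<n}" for i
        using C'(2)[of "b i" "a i"] * that by auto
    qed
    also have "\<dots> = C' * (\<Sum>i<n. b i - a i)" by (simp add: sum_distrib_left)
    also have "\<dots> < C' * (e / C')" using * C'(1) by (intro mult_strict_left_mono) auto
    finally show "(\<Sum>i<n. \<bar>g (b i) - g (a i)\<bar>) < e" using C'(1) by simp
  qed (use \<open>0 < e\<close> C'(1) in simp)
qed

text \<open>Since \<open>phi (deriv v t)\<close> is exactly \<open>p t\<close>, the equation is the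
  momentum equation almost everywhere. The velocity is Lipschitz, hence absolutely continuous, and
  \<open>f\<close> matters only on ]0, 1[.\<close>

lemma (in relativistic_system) flow_heteroclinic_solution:
  assumes flow: "flow Q g v p" and p: "\<And>t. 0 < p t" and v: "\<And>t. v t \<in> {0<..<1}"
    and lim: "(v \<longlongrightarrow> 0) at_bot" "(v \<longlongrightarrow> 1) at_top"
    and Q: "AE t in lebesgue. Q t = q t" and f: "\<And>x. x \<in> {0<..<1} \<Longrightarrow> f x = - \<delta> * g x"
  shows "heteroclinic_solution \<delta> q f v"
  unfolding heteroclinic_solution_def is_solution_def
proof (intro conjI allI)
  have deriv: "deriv v = (\<lambda>t. psi (p t))"
    using flow_DERIV[OF flow] by (auto intro: DERIV_imp_deriv)
  show "v t \<in> {0..1}" for t using v[of t] by simp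
  show "\<bar>deriv v t\<bar> < 1" for t by (simp add: deriv abs_psi_less_1)
  have "continuous_on UNIV (\<lambda>t. psi (p t))"
    by (rule continuous_on_compose2[OF continuous_on_psi continuous_on_flow(2)[OF flow]]) auto
  then show "v C1_differentiable_on UNIV"
    unfolding C1_differentiable_on_def using flow_DERIV[OF flow]
    by (auto simp: has_real_derivative_iff_has_vector_derivative intro!: exI[of _ "\<lambda>t. psi (p t)"])
  show "absolutely_continuous_on UNIV (deriv v)"
    unfolding deriv
    by (rule absolutely_continuous_on_lipschitz[OF order_trans[OF psi_lipschitz flow_lipschitz[OF flow]]])
  show "AE t in lebesgue. \<exists>D. ((\<lambda>s. phi (deriv v s)) has_real_derivative D) (at t) \<and>
      \<delta> * D + q t * f (v t) = 0"
    using AE_flow_DERIV[OF flow] Q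
    by eventually_elim (use f[OF v] in \<open>auto simp: deriv phi_psi intro!: exI\<close>)
  show "strict_mono v"
    by (intro strict_monoI flow_increasing[OF flow] p)
qed (fact lim)+

theorem theorem3p5:
  fixes \<delta> t\<^sub>0 \<eta> c \<alpha> :: real and q f :: "real \<Rightarrow> real"
  assumes "\<delta> > 0"
    and "L_infinity_on {..<t\<^sub>0} q"
    and "\<eta> > 0"
    and "AE t in lebesgue_on {..<t\<^sub>0}. q t \<ge> \<eta>"
    and "c > 0"
    and "\<forall>t\<ge>t\<^sub>0. q t = c"
    and "\<exists>L. L-lipschitz_on {0..1} f"
    and "f 0 = 0" and "f 1 = 0"
    and "\<alpha> \<in> {0<..<1}"
    and "f \<alpha> = 0"
    and "\<forall>s\<in>{0<..<\<alpha>}. f s < 0"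
    and "\<forall>s\<in>{\<alpha><..<1}. f s > 0"
    and "potential f 1 > 0"
    and "c \<le> \<eta> * (- potential f \<alpha> / (potential f 1 - potential f \<alpha>))"
  shows "\<exists>v. strict_mono v \<and> heteroclinic_solution \<delta> q f v"
proof -
  obtain K0 where q: "q \<in> borel_measurable (lebesgue_on {..<t\<^sub>0})"
    and K0: "AE t in lebesgue_on {..<t\<^sub>0}. \<bar>q t\<bar> \<le> K0"
    using assms(2) by (auto simp: L_infinity_on_def)
  \<comment> \<open>The bounds on \<open>q\<close> hold almost everywhere; clipping enforces them
    everywhere without changing the class of \<open>q\<close>. The point \<open>t\<^sub>0\<close>
    joins the left branch, as \<open>Q_before\<close> demands.\<close>
  define Q where "Q t = (if t \<le> t\<^sub>0 then max \<eta> (min K0 (if t \<in> {..<t\<^sub>0} then q t else 0)) else c)" for t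
  have [measurable]: "(\<lambda>t. if t \<in> {..<t\<^sub>0} then q t else 0) \<in> borel_measurable lebesgue"
    using q by (intro borel_measurable_if_I) auto
  have [measurable]: "(\<lambda>t :: real. t) \<in> borel_measurable lebesgue"
    by (rule measurable_completion) simp
  have Q_meas: "Q \<in> borel_measurable lebesgue"
    unfolding Q_def[abs_def] by measurable
  have "AE t in lebesgue. t \<notin> {t\<^sub>0}"
    by (intro AE_not_in) (simp flip: negligible_iff_null_sets)
  moreover have "AE t in lebesgue. t \<in> {..<t\<^sub>0} \<longrightarrow> \<bar>q t\<bar> \<le> K0"
    using K0 by (subst (asm) AE_restrict_space_iff) auto
  moreover have "AE t in lebesgue. t \<in> {..<t\<^sub>0} \<longrightarrow> \<eta> \<le> q t"
    using assms(4) by (subst (asm) AE_restrict_space_iff) auto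
  ultimately have Q_eq: "AE t in lebesgue. Q t = q t"
    by eventually_elim (use assms(6) in \<open>auto simp: Q_def\<close>)

  obtain L where L: "L-lipschitz_on {0..1} f" using assms(7) by blast
  then have "0 \<le> L" by (rule lipschitz_on_nonneg)
  \<comment> \<open>Clamping the argument to [0, 1] keeps the Lipschitz constant, and with
    \<open>f 0 = 0\<close> also bounds the extension by \<open>L\<close>.\<close>
  define fb where "fb x = f (max 0 (min 1 x))" for x :: real
  have fb: "fb x = f x" if "x \<in> {0..1}" for x using that by (simp add: fb_def)
  have fb_lip: "\<bar>fb x - fb y\<bar> \<le> L * \<bar>x - y\<bar>" for x y
  proof -
    have "\<bar>fb x - fb y\<bar> \<le> L * \<bar>max 0 (min 1 x) - max 0 (min 1 y)\<bar>"
      using lipschitz_onD[OF L, of "max 0 (min 1 x)" "max 0 (min 1 y)"] by (simp add: fb_def dist_real_def)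
    also have "\<dots> \<le> L * \<bar>x - y\<bar>" using \<open>0 \<le> L\<close> by (intro mult_left_mono) auto
    finally show ?thesis .
  qed
  have fb_bound: "\<bar>fb x\<bar> \<le> L" for x
  proof -
    have "\<bar>fb x\<bar> \<le> L * \<bar>max 0 (min 1 x) - 0\<bar>"
      using lipschitz_onD[OF L, of "max 0 (min 1 x)" 0] assms(8) by (simp add: fb_def dist_real_def)
    also have "\<dots> \<le> L * 1" using \<open>0 \<le> L\<close> by (intro mult_left_mono) auto
    finally show ?thesis by simp
  qed
  define g where "g x = - fb x / \<delta>" for x
  interpret relativistic_system Q g "min \<eta> c" "max (max \<eta> K0) c" "L / \<delta>" "L / \<delta>"
  proof
    show "\<bar>g x - g y\<bar> \<le> L / \<delta> * \<bar>x - y\<bar>" for x y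
      using divide_right_mono[OF fb_lip[of x y], of \<delta>] assms(1)
      by (simp add: g_def abs_minus_commute flip: diff_divide_distrib)
    show "\<bar>g x\<bar> \<le> L / \<delta>" for x
      using divide_right_mono[OF fb_bound[of x], of \<delta>] assms(1) by (simp add: g_def)
  qed (use Q_meas assms(1,3,5) \<open>0 \<le> L\<close> in \<open>auto simp: Q_def\<close>)

  have cont_fb: "continuous_on S fb" for S
    using continuous_on_mult_left[OF continuous_on_g, of S "- \<delta>"] assms(1) by (simp add: g_def)
  have fb_int: "fb integrable_on {x..y}" for x y
    by (rule integrable_continuous_real[OF cont_fb])
  \<comment> \<open>Starting at -1 makes 0 an interior point, so that \<open>U\<close> has two-sided
    derivatives on [0, 1]. The extension vanishes on [-1, 0], hence \<open>U\<close> still equals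
    \<open>F / \<delta>\<close> on [0, 1].\<close>
  define U where "U x = integral {-1..x} fb / \<delta>" for x
  have DERIV_U: "(U has_real_derivative - g x) (at x)" if "x \<in> {0..1}" for x
  proof -
    have "((\<lambda>u. integral {-1..u} fb) has_real_derivative fb x) (at x within {-1..2})"
      by (rule integral_has_real_derivative[OF cont_fb]) (use that in auto)
    then have "((\<lambda>u. integral {-1..u} fb) has_real_derivative fb x) (at x)"
      using that by (simp add: at_within_Icc_at)
    then show ?thesis
      unfolding U_def g_def using assms(1) by (auto intro!: derivative_eq_intros)
  qed
  have U: "U x = potential f x / \<delta>" if "x \<in> {0..1}" for x
  proof -
    have "integral {-1..0} fb = integral {-1..0} (\<lambda>_ :: real. 0 :: real)"
      by (rule Henstock_Kurzweil_Integration.integral_cong) (simp add: fb_def assms(8))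
    moreover have "integral {0..x} fb = potential f x"
      unfolding potential_def using that by (intro Henstock_Kurzweil_Integration.integral_cong fb) auto
    ultimately show ?thesis
      using Henstock_Kurzweil_Integration.integral_combine[of "-1" 0 x fb] that fb_int by (simp add: U_def)
  qed
  have U0: "U 0 = 0" using U[of 0] by (simp add: potential_def)
  have U_left: "U x \<le> 0" if "x \<in> {0..\<alpha>}" for x
  proof -
    have "U x \<le> U 0"
    proof (rule DERIV_nonpos_imp_nonincreasing[where f = U])
      fix z assume z: "0 \<le> z" "z \<le> x"
      then have "f z \<le> 0"
        using that assms(8,11,12) by (cases "z = 0"; cases "z = \<alpha>") (auto intro: less_imp_le)
      then have "- g z \<le> 0"
        using z that assms(1,10) fb[of z] by (simp add: g_def divide_nonpos_pos)
      then show "\<exists>y. (U has_real_derivative y) (at z) \<and> y \<le> 0"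
        using z that assms(10) DERIV_U[of z] by auto
    qed (use that in simp)
    then show ?thesis by (simp add: U0)
  qed
  have U1: "0 < U 1" using U[of 1] assms(1,14) by simp
  \<comment> \<open>Up to \<alpha> the potential is nonpositive while \<open>U 1 > 0\<close>; beyond
    \<alpha> it increases strictly.\<close>
  have U_less: "U x < U 1" if "x \<in> {0..<1}" for x
  proof (cases "x \<le> \<alpha>")
    case True
    then show ?thesis using U_left[of x] U1 that by simp
  next
    case False
    show ?thesis
    proof (rule DERIV_pos_imp_increasing_open[where f = U])
      show "\<exists>y. (U has_real_derivative y) (at z) \<and> 0 < y" if z: "x < z" "z < 1" for z
        using z False assms(1,10,13) fb[of z] DERIV_U[of z]
        by (intro exI[of _ "- g z"]) (auto simp: g_def)
      have "continuous_on {0..1} U"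
        by (rule DERIV_continuous_on[OF has_field_derivative_at_within[OF DERIV_U]])
      then show "continuous_on {x..1} U"
        by (rule continuous_on_subset) (use \<open>x \<in> {0..<1}\<close> in auto)
    qed (use that in simp)
  qed
  \<comment> \<open>The hypothesis on \<open>c\<close> multiplied by
    \<open>F(1) - F(\<alpha>) > 0\<close> and divided by \<delta>.\<close>
  have threshold: "c * (U 1 - U \<alpha>) + \<eta> * U \<alpha> \<le> 0"
  proof -
    let ?D = "potential f 1 - potential f \<alpha>"
    have UD: "U 1 - U \<alpha> = ?D / \<delta>" "U \<alpha> = potential f \<alpha> / \<delta>"
      using U[of 1] U[of \<alpha>] assms(10) by (simp_all add: diff_divide_distrib)
    then have "0 < ?D / \<delta>" using U_less[of \<alpha>] assms(10) by simp
    then have "0 < ?D" using assms(1) by (simp add: zero_less_divide_iff)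
    then have "c * ?D \<le> - \<eta> * potential f \<alpha>"
      using mult_right_mono[OF assms(15), of ?D] by simp
    then have "(c * ?D + \<eta> * potential f \<alpha>) / \<delta> \<le> 0"
      using assms(1) by (simp add: divide_nonpos_pos)
    then show ?thesis unfolding UD(1) unfolding UD(2) by (simp add: add_divide_distrib)
  qed
  interpret bistable_step Q g "min \<eta> c" "max (max \<eta> K0) c" "L / \<delta>" "L / \<delta>" U t\<^sub>0 \<eta> c \<alpha>
  proof
    show "0 < g x" if "x \<in> {0<..<\<alpha>}" for x
      using that assms(1,10,12) fb[of x] by (auto simp: g_def divide_neg_pos)
  qed (use assms(3,5,8-10) U0 U_less DERIV_U threshold in \<open>auto simp: Q_def g_def fb_def\<close>)
  obtain v p where vp: "flow Q g v p" "\<And>t. 0 < p t" "\<And>t. v t \<in> {0<..<1}"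
    "(v \<longlongrightarrow> 0) at_bot" "(v \<longlongrightarrow> 1) at_top"
    using that by (rule heteroclinic_flow)
  have "heteroclinic_solution \<delta> q f v"
    by (rule flow_heteroclinic_solution[OF vp Q_eq]) (use assms(1) fb in \<open>simp add: g_def\<close>)
  then show ?thesis by (auto simp: heteroclinic_solution_def)
qed

end
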